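(* Let $k\ge 0$ be an integer and let $G$ be a group acting by automorphisms, without inversions, non-elementarily and $k$-acylindrically on a simplicial tree $\mathcal T$. Then for any finite generating set $S$ of $G$ of cardinality $n$ one has $$\operatorname{Ent}(G,S)\ \ge\ \frac{\log\left(\sqrt[32]{n}-1\right)}{80(k+3)}.$$
   Context: A simplicial tree $\mathcal T$ is endowed with its simplicial distance $d_{\mathcal T}$ (all edges have length $1$). An action is without inversions if no element swaps the two endpoints of an edge. An element $g$ is elliptic if its translation length $\tau(g)=\inf_{v\in\mathcal T}d_{\mathcal T}(v,gv)$ is $0$, and hyperbolic otherwise. The action of $G$ is $k$-acylindrical if the fixed point set of every nontrivial elliptic element of $G$ has diameter at most $k$. Let $\mathcal T_G$ be the minimal $G$-invariant subtree; the action is elementary if $\mathcal T_G$ is a point or a line, and non-elementary otherwise. For a finite generating set $S$ of $G$, the entropy is $\operatorname{Ent}(G,S)=\lim_{m\to\infty}\frac1m\log|S^m|$, where $S^m$ denotes the ball of radius $m$ centered at the identity for the word metric of $S$. (The inequality makes sense, and has content, only for $n$ large.) *)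

theory Defs
  imports Complex_Main "HOL-Library.Extended_Nat" "HOL-Algebra.Group_Action"
    "HOL-Algebra.Generated_Groups"
begin

text \<open>
  A simplicial tree is given by its vertex set \<open>V\<close> and its adjacency relation \<open>E\<close>. Subtrees are
  given by their vertex sets: in a tree, a connected subgraph is induced by its vertices.
\<close>

definition connected_in :: "('v \<Rightarrow> 'v \<Rightarrow> bool) \<Rightarrow> 'v set \<Rightarrow> bool" where
  "connected_in E W \<longleftrightarrow> (\<forall>x\<in>W. \<forall>y\<in>W. (\<lambda>a b. a \<in> W \<and> b \<in> W \<and> E a b)\<^sup>*\<^sup>* x y)"

definition graph_cycle :: "('v \<Rightarrow> 'v \<Rightarrow> bool) \<Rightarrow> 'v list \<Rightarrow> bool" where
  "graph_cycle E xs \<longleftrightarrow>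
     length xs \<ge> 3 \<and> distinct xs \<and> successively E xs \<and> E (last xs) (hd xs)"

locale simplicial_tree =
  fixes V :: "'v set" and E :: "'v \<Rightarrow> 'v \<Rightarrow> bool"
  assumes vertices_nonempty: "V \<noteq> {}"
    and adj_in_V: "E x y \<Longrightarrow> x \<in> V \<and> y \<in> V"
    and adj_sym: "E x y \<Longrightarrow> E y x"
    and adj_irrefl: "\<not> E x x"
    and connected: "connected_in E V"
    and acyclic: "\<not> graph_cycle E xs"

definition tree_dist :: "('v \<Rightarrow> 'v \<Rightarrow> bool) \<Rightarrow> 'v \<Rightarrow> 'v \<Rightarrow> nat" where
  "tree_dist E x y = (LEAST n. (E ^^ n) x y)"

definition tree_diameter :: "('v \<Rightarrow> 'v \<Rightarrow> bool) \<Rightarrow> 'v set \<Rightarrow> enat" where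
  "tree_diameter E W = (SUP x\<in>W. SUP y\<in>W. enat (tree_dist E x y))"

definition subtree :: "'v set \<Rightarrow> ('v \<Rightarrow> 'v \<Rightarrow> bool) \<Rightarrow> 'v set \<Rightarrow> bool" where
  "subtree V E W \<longleftrightarrow> W \<subseteq> V \<and> W \<noteq> {} \<and> connected_in E W"

definition is_point :: "'v set \<Rightarrow> bool" where
  "is_point W \<longleftrightarrow> (\<exists>v. W = {v})"

definition is_line :: "('v \<Rightarrow> 'v \<Rightarrow> bool) \<Rightarrow> 'v set \<Rightarrow> bool" where
  "is_line E W \<longleftrightarrow>
     (\<exists>f :: int \<Rightarrow> 'v. bij_betw f UNIV W \<and> (\<forall>i j. E (f i) (f j) \<longleftrightarrow> \<bar>i - j\<bar> = 1))"

locale tree_action = simplicial_tree V E + group_action G V \<phi>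
  for G :: "('g, 'm) monoid_scheme" and V :: "'v set" and E :: "'v \<Rightarrow> 'v \<Rightarrow> bool"
    and \<phi> :: "'g \<Rightarrow> 'v \<Rightarrow> 'v" +
  assumes automorphism:
    "g \<in> carrier G \<Longrightarrow> x \<in> V \<Longrightarrow> y \<in> V \<Longrightarrow> E (\<phi> g x) (\<phi> g y) \<longleftrightarrow> E x y"

definition without_inversions ::
  "('g, 'm) monoid_scheme \<Rightarrow> ('v \<Rightarrow> 'v \<Rightarrow> bool) \<Rightarrow> ('g \<Rightarrow> 'v \<Rightarrow> 'v) \<Rightarrow> bool" where
  "without_inversions G E \<phi> \<longleftrightarrow>
     \<not> (\<exists>g\<in>carrier G. \<exists>x y. E x y \<and> \<phi> g x = y \<and> \<phi> g y = x)"

text \<open>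
  Translation lengths and fixed point sets range over vertices only. For an automorphism without
  inversions this changes neither the infimum of the displacement, nor the diameter of the fixed
  point set, with respect to the geometric realisation.
\<close>

definition translation_length ::
  "'v set \<Rightarrow> ('v \<Rightarrow> 'v \<Rightarrow> bool) \<Rightarrow> ('g \<Rightarrow> 'v \<Rightarrow> 'v) \<Rightarrow> 'g \<Rightarrow> nat" where
  "translation_length V E \<phi> g = (INF v\<in>V. tree_dist E v (\<phi> g v))"

definition elliptic ::
  "'v set \<Rightarrow> ('v \<Rightarrow> 'v \<Rightarrow> bool) \<Rightarrow> ('g \<Rightarrow> 'v \<Rightarrow> 'v) \<Rightarrow> 'g \<Rightarrow> bool" where
  "elliptic V E \<phi> g \<longleftrightarrow> translation_length V E \<phi> g = 0"

definition fixed_points :: "'v set \<Rightarrow> ('g \<Rightarrow> 'v \<Rightarrow> 'v) \<Rightarrow> 'g \<Rightarrow> 'v set" where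
  "fixed_points V \<phi> g = {v \<in> V. \<phi> g v = v}"

definition acylindrical ::
  "('g, 'm) monoid_scheme \<Rightarrow> 'v set \<Rightarrow> ('v \<Rightarrow> 'v \<Rightarrow> bool) \<Rightarrow> ('g \<Rightarrow> 'v \<Rightarrow> 'v) \<Rightarrow> nat \<Rightarrow> bool" where
  "acylindrical G V E \<phi> k \<longleftrightarrow>
     (\<forall>g\<in>carrier G. g \<noteq> \<one>\<^bsub>G\<^esub> \<and> elliptic V E \<phi> g \<longrightarrow>
        tree_diameter E (fixed_points V \<phi> g) \<le> enat k)"

definition invariant_subtree ::
  "('g, 'm) monoid_scheme \<Rightarrow> 'v set \<Rightarrow> ('v \<Rightarrow> 'v \<Rightarrow> bool) \<Rightarrow> ('g \<Rightarrow> 'v \<Rightarrow> 'v) \<Rightarrow> 'v set \<Rightarrow> bool" where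
  "invariant_subtree G V E \<phi> W \<longleftrightarrow> subtree V E W \<and> (\<forall>g\<in>carrier G. \<phi> g ` W = W)"

definition minimal_subtree ::
  "('g, 'm) monoid_scheme \<Rightarrow> 'v set \<Rightarrow> ('v \<Rightarrow> 'v \<Rightarrow> bool) \<Rightarrow> ('g \<Rightarrow> 'v \<Rightarrow> 'v) \<Rightarrow> 'v set \<Rightarrow> bool" where
  "minimal_subtree G V E \<phi> W \<longleftrightarrow>
     invariant_subtree G V E \<phi> W \<and>
     (\<forall>W'. invariant_subtree G V E \<phi> W' \<and> W' \<subseteq> W \<longrightarrow> W' = W)"

text \<open>
  Two distinct minimal invariant subtrees are disjoint, and the segment joining them is fixed
  pointwise, so both are points. Hence a minimal invariant subtree that is not a point is unique,
  and the existential quantifier below speaks about the minimal invariant subtree.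
\<close>

definition non_elementary ::
  "('g, 'm) monoid_scheme \<Rightarrow> 'v set \<Rightarrow> ('v \<Rightarrow> 'v \<Rightarrow> bool) \<Rightarrow> ('g \<Rightarrow> 'v \<Rightarrow> 'v) \<Rightarrow> bool" where
  "non_elementary G V E \<phi> \<longleftrightarrow>
     (\<exists>W. minimal_subtree G V E \<phi> W \<and> \<not> is_point W \<and> \<not> is_line E W)"

text \<open>
  Words are written in the letters \<open>S\<close> and their inverses; \<open>S\<close> itself need not be symmetric.
\<close>

definition word_length :: "('g, 'm) monoid_scheme \<Rightarrow> 'g set \<Rightarrow> 'g \<Rightarrow> nat" where
  "word_length G S g =
     (LEAST l. \<exists>ws. set ws \<subseteq> S \<union> (\<lambda>s. inv\<^bsub>G\<^esub> s) ` S \<and> length ws = l \<and>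
                    foldr (\<otimes>\<^bsub>G\<^esub>) ws \<one>\<^bsub>G\<^esub> = g)"

definition word_dist :: "('g, 'm) monoid_scheme \<Rightarrow> 'g set \<Rightarrow> 'g \<Rightarrow> 'g \<Rightarrow> nat" where
  "word_dist G S g h = word_length G S (inv\<^bsub>G\<^esub> g \<otimes>\<^bsub>G\<^esub> h)"

definition word_ball :: "('g, 'm) monoid_scheme \<Rightarrow> 'g set \<Rightarrow> nat \<Rightarrow> 'g set" where
  "word_ball G S m = {g \<in> carrier G. word_dist G S \<one>\<^bsub>G\<^esub> g \<le> m}"

definition entropy :: "('g, 'm) monoid_scheme \<Rightarrow> 'g set \<Rightarrow> real" where
  "entropy G S = lim (\<lambda>m. ln (real (card (word_ball G S m))) / real m)"

end

theory Submission imports Defs begin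

text \<open>
  By Serre's lemma some product \<open>h\<close> of at most two generators is hyperbolic, and non-elementarity
  gives a generator \<open>t\<close> with \<open>t h t\<^sup>-\<^sup>1 \<noteq> h, h\<^sup>-\<^sup>1\<close>. By acylindricity, an element commuting with
  both \<open>h\<close> and \<open>t h t\<^sup>-\<^sup>1\<close> is trivial, so words of length 3 conjugate \<open>h\<close> to at least
  \<open>\<surd>n\<close> different elements, all of the same translation length \<open>\<tau>\<close>. Two of them that are neither
  equal nor inverse to each other have axes that overlap in length at most \<open>\<tau> + k\<close>.

  Seen from a base point \<open>x\<close>, write \<open>i \<prec> j\<close> if the axis of \<open>j\<close> projects to the axis of \<open>i\<close> far from
  the projection of \<open>x\<close>. This is a strict partial order, so the family contains a chain or an
  antichain of the square root of its size. In such a subfamily all the other axes project to a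
  given axis close to one of at most two points. One of the powers \<open>P\<close> and \<open>2 P\<close> of the corresponding
  element, where \<open>P\<close> is linear in \<open>k\<close>, moves these points far away from each other and from
  themselves, and the chosen powers play ping-pong. Words in them without two equal consecutive
  letters represent distinct elements, whence the growth rate \<open>ln (m - 1)\<close> for \<open>m\<close> letters.
\<close>

section \<open>Geodesics in simplicial trees\<close>

text \<open>The obstacle is that the other axes may project to places spread all along a given axis,
  so that every power of bounded size could carry one such place onto another. A chain or an
  antichain leaves at most two places, but at an unknown distance from each other; a single power
  might still move one onto the other, which is why two powers are offered. Ping-pong gives no
  information about a letter on its own ping-pong set, hence the words without equal neighbours.

  Constants: the projection of one axis to another has diameter at most D = \<tau> + k, the places
  have radius 2 D, and the power must satisfy P \<tau> > 8 D. As \<tau> \<ge> 1, the choice P = 8 k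
  + 9 works whatever \<tau> is. A letter is a power up to 2 P of an element of length at most 2,
  conjugated by one of length at most 3, so its length is at most 6 + 4 P = 32 k + 42 \<le> 80 (k +
  3). Two square roots and one halving, which discards inverses, give n \<le> 4 m^4 for m letters.
  If n > 2^32, this bounds the 32nd root of n by m; for smaller n the claimed bound is not
  positive.\<close>

definition nb_walk :: "('v \<Rightarrow> 'v \<Rightarrow> bool) \<Rightarrow> (nat \<Rightarrow> 'v) \<Rightarrow> nat \<Rightarrow> bool" where
  "nb_walk E f n \<longleftrightarrow>
     (\<forall>i<n. E (f i) (f (Suc i))) \<and> (\<forall>i. Suc (Suc i) \<le> n \<longrightarrow> f i \<noteq> f (Suc (Suc i)))"

context simplicial_tree
begin

abbreviation d :: "'v \<Rightarrow> 'v \<Rightarrow> nat" where "d \<equiv> tree_dist E"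

lemma adj_V: "E x y \<Longrightarrow> x \<in> V" "E x y \<Longrightarrow> y \<in> V"
  using adj_in_V by auto

text \<open>A shortest closed piece of the walk has length at least 3, because there are no loops
  and no backtracking; by minimality its vertices are distinct, so it is a
  \<open>graph_cycle\<close>. Acyclicity enters all later arguments through this lemma.\<close>

lemma nb_walk_closed_trivial:
  assumes f: "nb_walk E f n" and "i < j" "j \<le> n" "f i = f j"
  shows False
proof -
  define P where "P l \<longleftrightarrow> l > 0 \<and> (\<exists>a. a + l \<le> n \<and> f a = f (a + l))" for l
  have "P (j - i)" using assms unfolding P_def by (auto intro!: exI[of _ i])
  then have P: "P (LEAST l. P l)" and least: "\<And>l. P l \<Longrightarrow> (LEAST l. P l) \<le> l"
    by (auto intro: LeastI Least_le)
  define l where "l = (LEAST l. P l)"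
  obtain a where a: "l > 0" "a + l \<le> n" "f a = f (a + l)"
    using P unfolding P_def l_def by blast
  have adj: "E (f i) (f (Suc i))" if "i < n" for i
    using f that by (auto simp: nb_walk_def)
  have nb: "f i \<noteq> f (Suc (Suc i))" if "Suc (Suc i) \<le> n" for i
    using f that by (auto simp: nb_walk_def)
  have "l \<noteq> 1" using adj[of a] a adj_irrefl by auto
  moreover have "l \<noteq> 2" using nb[of a] a by auto
  ultimately have l3: "l \<ge> 3" using a by linarith
  define xs where "xs = map (\<lambda>i. f (a + i)) [0..<l]"
  have "inj_on (\<lambda>i. f (a + i)) {0..<l}"
  proof (rule linorder_inj_onI)
    fix p q assume pq: "p < q" "p \<in> {0..<l}" "q \<in> {0..<l}"
    show "f (a + p) \<noteq> f (a + q)"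
    proof
      assume "f (a + p) = f (a + q)"
      then have "P (q - p)" unfolding P_def using pq a by (auto intro!: exI[of _ "a + p"])
      then show False using least[of "q - p"] pq unfolding l_def[symmetric] by auto
    qed
  qed auto
  then have "distinct xs" by (simp add: xs_def distinct_map)
  moreover have "successively E xs"
    using adj a by (auto simp: successively_conv_nth xs_def)
  moreover have "E (last xs) (hd xs)"
  proof -
    have "last xs = f (a + (l - 1))" "hd xs = f a"
      using l3 by (auto simp: xs_def last_map hd_map)
    moreover have "E (f (a + (l - 1))) (f (a + l))" using adj[of "a + (l - 1)"] a by auto
    ultimately show ?thesis using a by simp
  qed
  ultimately have "graph_cycle E xs" using l3 by (simp add: graph_cycle_def xs_def)
  then show False using acyclic by blast
qed

lemma nb_walk_shift:
  assumes "nb_walk E f n" shows "nb_walk E (\<lambda>i. f (i + a)) (n - a)"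
  unfolding nb_walk_def
proof (intro conjI allI impI)
  fix i show "E (f (i + a)) (f (Suc i + a))" if "i < n - a"
    using assms that by (auto simp: nb_walk_def)
  show "f (i + a) \<noteq> f (Suc (Suc i) + a)" if "Suc (Suc i) \<le> n - a"
    using assms[unfolded nb_walk_def, THEN conjunct2, rule_format, of "i + a"] that by auto
qed

lemma nb_walk_take: "nb_walk E f n \<Longrightarrow> m \<le> n \<Longrightarrow> nb_walk E f m"
  by (auto simp: nb_walk_def)

lemma nb_walk_rev:
  assumes "nb_walk E f n" shows "nb_walk E (\<lambda>i. f (n - i)) n"
  unfolding nb_walk_def
proof (intro conjI allI impI)
  fix i assume "i < n"
  then have "E (f (n - Suc i)) (f (Suc (n - Suc i)))" using assms by (auto simp: nb_walk_def)
  then show "E (f (n - i)) (f (n - Suc i))" using \<open>i < n\<close> by (metis Suc_diff_Suc adj_sym)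
next
  fix i assume "Suc (Suc i) \<le> n"
  then show "f (n - i) \<noteq> f (n - Suc (Suc i))"
    using assms[unfolded nb_walk_def, THEN conjunct2, rule_format, of "n - Suc (Suc i)"]
    by (metis Suc_diff_Suc Suc_le_lessD diff_le_self less_or_eq_imp_le order_less_le_trans)
qed

lemma nb_walk_append:
  assumes f: "nb_walk E f n" and g: "nb_walk E g m" and "f n = g 0"
    and "n > 0 \<Longrightarrow> m > 0 \<Longrightarrow> f (n - 1) \<noteq> g 1"
  shows "nb_walk E (\<lambda>i. if i \<le> n then f i else g (i - n)) (n + m)"
  unfolding nb_walk_def
proof (intro conjI allI impI)
  fix i assume i: "i < n + m"
  consider "i < n" | "i = n" | "i > n" by linarith
  then show "E (if i \<le> n then f i else g (i - n)) (if Suc i \<le> n then f (Suc i) else g (Suc i - n))"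
  proof cases
    case 3
    then have "E (g (i - n)) (g (Suc (i - n)))" using g i by (auto simp: nb_walk_def)
    then show ?thesis using 3 by (simp add: Suc_diff_le)
  qed (use assms i in \<open>auto simp: nb_walk_def\<close>)
next
  fix i assume i: "Suc (Suc i) \<le> n + m"
  consider "Suc (Suc i) \<le> n" | "Suc i = n" | "i = n" | "i > n" by linarith
  then show "(if i \<le> n then f i else g (i - n)) \<noteq>
      (if Suc (Suc i) \<le> n then f (Suc (Suc i)) else g (Suc (Suc i) - n))"
  proof cases
    case 2 then show ?thesis using assms(4) i by auto
  next
    case 3 
    then have "g 0 \<noteq> g (Suc (Suc 0))" using g i by (auto simp: nb_walk_def)
    then show ?thesis using 3 assms(3) by (auto simp: numeral_2_eq_2)
  next
    case 4
    then have "g (i - n) \<noteq> g (Suc (Suc (i - n)))" using g i by (auto simp: nb_walk_def)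
    moreover have "Suc (Suc i) - n = Suc (Suc (i - n))" using 4 by linarith
    ultimately show ?thesis using 4 by simp
  qed (use f in \<open>auto simp: nb_walk_def\<close>)
qed

text \<open>Equal first steps are stripped by induction. If the first steps differ, \<open>f\<close>
  run backwards and followed by \<open>g\<close> is a closed walk that does not backtrack at the
  junction either.\<close>

lemma nb_walk_unique:
  assumes "nb_walk E f n" "nb_walk E g m" "f 0 = g 0" "f n = g m"
  shows "n = m \<and> (\<forall>i\<le>n. f i = g i)"
  using assms
proof (induction n arbitrary: m f g)
  case 0
  have "m = 0"
    using nb_walk_closed_trivial[OF 0(2), of 0 m] 0 by (cases m) auto
  then show ?case using 0 by auto
next
  case (Suc n)
  show ?case
  proof (cases m)
    case 0
    then show ?thesis using nb_walk_closed_trivial[OF Suc(2), of 0 "Suc n"] Suc by auto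
  next
    case (Suc m')
    show ?thesis
    proof (cases "f 1 = g 1")
      case True
      have "n = m' \<and> (\<forall>i\<le>n. f (i + 1) = g (i + 1))"
        using Suc.IH[OF nb_walk_shift[OF Suc.prems(1), of 1, simplified]
            nb_walk_shift[OF Suc.prems(2), of 1, unfolded Suc, simplified]] True Suc.prems Suc
        by simp
      then show ?thesis using Suc Suc.prems
        by (metis Suc_eq_plus1 less_eq_nat.simps(1) not0_implies_Suc Suc_le_mono)
    next
      case False
      define u where "u i = (if i \<le> Suc n then f (Suc n - i) else g (i - Suc n))" for i
      have "nb_walk E u (Suc n + m)" unfolding u_def
        by (rule nb_walk_append[OF nb_walk_rev[OF Suc.prems(1)] Suc.prems(2)])
           (use Suc.prems False in auto)
      moreover have "u 0 = u (Suc n + m)" using Suc.prems Suc by (simp add: u_def)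
      ultimately show ?thesis using nb_walk_closed_trivial[of u "Suc n + m" 0 "Suc n + m"] by auto
    qed
  qed
qed

section \<open>Distances, geodesics, medians and the four-point condition\<close>

lemma walk_exists: assumes "x \<in> V" "y \<in> V" shows "\<exists>n. (E ^^ n) x y"
proof -
  have "(\<lambda>a b. a \<in> V \<and> b \<in> V \<and> E a b)\<^sup>*\<^sup>* x y"
    using connected assms by (auto simp: connected_in_def)
  then have "E\<^sup>*\<^sup>* x y" by (rule rtranclp_mono[THEN predicate2D, rotated]) auto
  then show ?thesis by (rule rtranclp_imp_relpowp)
qed

lemma dist_walk: assumes "x \<in> V" "y \<in> V" shows "(E ^^ d x y) x y"
  unfolding tree_dist_def using walk_exists[OF assms] by (rule LeastI_ex)

lemma dist_le: "(E ^^ n) x y \<Longrightarrow> d x y \<le> n"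
  unfolding tree_dist_def by (rule Least_le)

lemma dist_self [simp]: "d x x = 0"
  using dist_le[of 0 x x] by simp

lemma dist_eq_0: "x \<in> V \<Longrightarrow> y \<in> V \<Longrightarrow> d x y = 0 \<longleftrightarrow> x = y"
  using dist_walk[of x y] by (auto)

lemma dist_triangle: "x \<in> V \<Longrightarrow> y \<in> V \<Longrightarrow> z \<in> V \<Longrightarrow> d x z \<le> d x y + d y z"
  by (meson dist_le dist_walk relpowp_trans)

text \<open>A backtrack in a shortest walk could be cut out, which would save two edges.\<close>

lemma geodesic_exists:
  assumes "x \<in> V" "y \<in> V"
  obtains f where "nb_walk E f (d x y)" "f 0 = x" "f (d x y) = y"
proof -
  let ?n = "d x y"
  obtain f where f: "f 0 = x" "f ?n = y" "\<And>i. i < ?n \<Longrightarrow> E (f i) (f (Suc i))"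
    using dist_walk[OF assms] by (auto simp: relpowp_fun_conv)
  have "f i \<noteq> f (Suc (Suc i))" if i: "Suc (Suc i) \<le> ?n" for i
  proof
    assume eq: "f i = f (Suc (Suc i))"
    have 1: "(E ^^ i) x (f i)"
      using f i by (auto simp: relpowp_fun_conv intro!: exI[of _ f])
    obtain m where m: "?n = m + Suc (Suc i)" using i by (metis le_add_diff_inverse2)
    have 2: "(E ^^ m) (f (Suc (Suc i))) y"
      unfolding relpowp_fun_conv
      by (rule exI[of _ "\<lambda>j. f (j + Suc (Suc i))"]) (use f m in auto)
    have "(E ^^ (i + m)) x y" using relpowp_trans[OF 1] 2 eq by simp
    then show False using dist_le[of "i + m" x y] m by linarith
  qed
  then show ?thesis using f that[of f] by (auto simp: nb_walk_def)
qed

lemma nb_walk_in_V: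
  assumes "nb_walk E f n" "f 0 \<in> V" "i \<le> n" shows "f i \<in> V"
proof (cases i)
  case (Suc j)
  then have "E (f j) (f i)" using assms by (auto simp: nb_walk_def)
  then show ?thesis using adj_V by auto
qed (use assms in auto)

lemma nb_walk_dist:
  assumes "nb_walk E f n" "f 0 \<in> V" shows "d (f 0) (f n) = n"
proof -
  have "f n \<in> V" using nb_walk_in_V assms by blast
  then obtain g where g: "nb_walk E g (d (f 0) (f n))" "g 0 = f 0" "g (d (f 0) (f n)) = f n"
    by (rule geodesic_exists[OF assms(2)])
  from nb_walk_unique[OF assms(1) g(1) g(2)[symmetric] g(3)[symmetric]] show ?thesis
    by (elim conjE) (rule sym)
qed

lemma nb_walk_dist2:
  assumes "nb_walk E f n" "f 0 \<in> V" "i \<le> j" "j \<le> n" shows "d (f i) (f j) = j - i"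
proof -
  have "nb_walk E (\<lambda>a. f (a + i)) (j - i)"
    using nb_walk_shift[OF nb_walk_take[OF assms(1,4)]] .
  then show ?thesis using nb_walk_dist[of "\<lambda>a. f (a + i)" "j - i"] assms
      nb_walk_in_V[OF assms(1,2), of i] by auto
qed

lemma dist_sym: assumes "x \<in> V" "y \<in> V" shows "d x y = d y x"
proof -
  obtain f where f: "nb_walk E f (d x y)" "f 0 = x" "f (d x y) = y"
    by (rule geodesic_exists[of x y]) (use assms in auto)
  define n where "n = d x y"
  have "d (f (n - 0)) (f (n - n)) = n"
    by (rule nb_walk_dist[OF nb_walk_rev]) (use f assms in \<open>simp_all add: n_def\<close>)
  then have "d y x = n" using f by (simp add: n_def)
  then show ?thesis by (simp add: n_def)
qed

lemma dist_1_iff: assumes "x \<in> V" "y \<in> V" shows "d x y = 1 \<longleftrightarrow> E x y"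
proof
  assume "d x y = 1" then show "E x y" using dist_walk[OF assms] by (metis relpowp_1)
next
  assume "E x y"
  then have "(E ^^ 1) x y" by (simp only: relpowp_1)
  then have "d x y \<le> 1" by (rule dist_le)
  moreover have "d x y \<noteq> 0" using dist_eq_0 assms \<open>E x y\<close> adj_irrefl by auto
  ultimately show "d x y = 1" by linarith
qed

lemma point_at_distance:
  assumes "x \<in> V" "y \<in> V" "i \<le> d x y"
  obtains z where "z \<in> V" "d x z = i" "d x z + d z y = d x y"
proof -
  obtain f where f: "nb_walk E f (d x y)" "f 0 = x" "f (d x y) = y"
    by (rule geodesic_exists[of x y]) (use assms in auto)
  have "d x (f i) = i" "d (f i) y = d x y - i"
    using nb_walk_dist2[OF f(1), of 0 i] nb_walk_dist2[OF f(1), of i "d x y"] f assms by auto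
  then show ?thesis using that[of "f i"] nb_walk_in_V[OF f(1)] f assms by auto
qed

text \<open>Geodesics from \<open>x\<close> to \<open>u\<close> and from \<open>u\<close> to
  \<open>y\<close> concatenate without backtracking, since a vertex repeated around \<open>u\<close>
  would give a shortcut. So both points lie on the one geodesic from \<open>x\<close> to
  \<open>y\<close>, where the distance from \<open>x\<close> determines the point.\<close>

lemma point_between_unique:
  assumes V: "x \<in> V" "y \<in> V" "u \<in> V" "v \<in> V"
    and u: "d x u + d u y = d x y" and v: "d x v + d v y = d x y" and uv: "d x u = d x v"
  shows "u = v"
proof -
  have *: "f (d x w) = w"
    if w: "w \<in> V" "d x w + d w y = d x y" and f: "nb_walk E f (d x y)" "f 0 = x" "f (d x y) = y"
    for w f
  proof -
    obtain p where p: "nb_walk E p (d x w)" "p 0 = x" "p (d x w) = w"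
    by (rule geodesic_exists[of x w]) (use V w in auto)
    obtain q where q: "nb_walk E q (d w y)" "q 0 = w" "q (d w y) = y"
    by (rule geodesic_exists[of w y]) (use V w in auto)
    define r where "r i = (if i \<le> d x w then p i else q (i - d x w))" for i
    have "nb_walk E r (d x w + d w y)" unfolding r_def
    proof (rule nb_walk_append[OF p(1) q(1)])
      assume pos: "d x w > 0" "d w y > 0"
      show "p (d x w - 1) \<noteq> q 1"
      proof
        assume eq: "p (d x w - 1) = q 1"
        have "d x (p (d x w - 1)) = d x w - 1"
          using nb_walk_dist2[OF p(1), of 0 "d x w - 1"] V p by auto
        moreover have "d (q 1) y = d w y - 1"
          using nb_walk_dist2[OF q(1), of 1 "d w y"] w q pos by auto
        moreover have "q 1 \<in> V" using nb_walk_in_V[OF q(1)] q w pos by auto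
        ultimately have "d x y \<le> d x w - 1 + (d w y - 1)"
          using dist_triangle[of x "q 1" y] V eq by auto
        then show False using pos w by linarith
      qed
    qed (use p q in auto)
    moreover have "r 0 = x" using p by (simp add: r_def)
    moreover have "r (d x w + d w y) = y" using p q by (auto simp: r_def)
    moreover have "r (d x w) = w" using p by (auto simp: r_def)
    ultimately show ?thesis using nb_walk_unique[of r "d x y" f "d x y"] w f
      by (metis le_add1)
  qed
  obtain f where "nb_walk E f (d x y)" "f 0 = x" "f (d x y) = y"
    by (rule geodesic_exists[of x y]) (use V in auto)
  then show ?thesis using *[of u f] *[of v f] assms by metis
qed

text \<open>The median is the point \<open>m\<close> nearest to \<open>z\<close> on the segment from
  \<open>x\<close> to \<open>y\<close>. The geodesic from \<open>z\<close> to \<open>m\<close>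
  continues towards either endpoint without backtracking, because otherwise the next point of the
  segment would be nearer to \<open>z\<close>.\<close>

lemma median_exists:
  assumes V: "x \<in> V" "y \<in> V" "z \<in> V"
  obtains m where "m \<in> V" "d x m + d m y = d x y" "d x m + d m z = d x z" "d y m + d m z = d y z"
proof -
  define S where "S = {m \<in> V. d x m + d m y = d x y}"
  have "x \<in> S" using V by (simp add: S_def)
  then obtain m where m: "m \<in> S" and min: "\<And>m'. m' \<in> S \<Longrightarrow> d z m \<le> d z m'"
    using arg_min_nat_lemma[of "\<lambda>m. m \<in> S" x "d z"] by metis
  have mV: "m \<in> V" using m S_def by auto
  have *: "d z w = d z m + d m w" if w: "w \<in> V"
    and sub: "\<And>m'. m' \<in> V \<Longrightarrow> d m m' + d m' w = d m w \<Longrightarrow> m' \<in> S" for w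
  proof -
    obtain p where p: "nb_walk E p (d z m)" "p 0 = z" "p (d z m) = m"
    by (rule geodesic_exists[of z m]) (use V mV in auto)
    obtain q where q: "nb_walk E q (d m w)" "q 0 = m" "q (d m w) = w"
    by (rule geodesic_exists[of m w]) (use w mV in auto)
    define r where "r i = (if i \<le> d z m then p i else q (i - d z m))" for i
    have "nb_walk E r (d z m + d m w)" unfolding r_def
    proof (rule nb_walk_append[OF p(1) q(1)])
      assume pos: "d z m > 0" "d m w > 0"
      show "p (d z m - 1) \<noteq> q 1"
      proof
        assume eq: "p (d z m - 1) = q 1"
        have "d z (p (d z m - 1)) = d z m - 1"
          using nb_walk_dist2[OF p(1), of 0 "d z m - 1"] V p by auto
        moreover have "d m (q 1) = 1" "d (q 1) w = d m w - 1"
          using nb_walk_dist2[OF q(1), of 1 "d m w"] nb_walk_dist2[OF q(1), of 0 1] mV q pos by auto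
        moreover have "q 1 \<in> V" using nb_walk_in_V[OF q(1)] q mV pos by auto
        ultimately show False using min[OF sub[of "q 1"]] eq pos by auto
      qed
    qed (use p q in auto)
    moreover have "r 0 = z" using p by (simp add: r_def)
    moreover have "r (d z m + d m w) = w" using p q by (auto simp: r_def)
    ultimately show ?thesis using nb_walk_dist[of r "d z m + d m w"] V by auto
  qed
  have mS: "d x m + d m y = d x y" using m S_def by auto
  have "d z x = d z m + d m x"
  proof (rule *[OF V(1)])
    fix m' assume m': "m' \<in> V" "d m m' + d m' x = d m x"
    then show "m' \<in> S" using dist_triangle[of m' m y] dist_triangle[of x m' y] mS
        dist_sym[of x m] dist_sym[of x m'] dist_sym[of m' m] V mV
      by (auto simp: S_def)
  qed
  moreover have "d z y = d z m + d m y"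
  proof (rule *[OF V(2)])
    fix m' assume m': "m' \<in> V" "d m m' + d m' y = d m y"
    then show "m' \<in> S" using dist_triangle[of x m m'] dist_triangle[of x m' y] mS V mV
      by (auto simp: S_def)
  qed
  ultimately show ?thesis using that[OF mV mS] dist_sym mV V by (metis add.commute)
qed

text \<open>Trees are 0-hyperbolic. The medians of \<open>w\<close>, \<open>x\<close>,
  \<open>z\<close> and of \<open>w\<close>, \<open>z\<close>, \<open>y\<close> both lie on the
  segment from \<open>w\<close> to \<open>z\<close>; the one nearer to \<open>w\<close> lies between
  \<open>w\<close> and the other, and the path through both of them gives one of the alternatives.
  Many metric arguments below are linear arithmetic over instances of this.\<close>

lemma four_point:
  assumes V: "x \<in> V" "y \<in> V" "z \<in> V" "w \<in> V"
  shows "d x y + d z w \<le> d x z + d y w \<or> d x y + d z w \<le> d x w + d y z"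
proof -
  have key: "d x z + d y w \<le> d x y + d w z \<or> d x z + d y w \<le> d y z + d w x"
    if H: "x \<in> V" "y \<in> V" "z \<in> V" "w \<in> V" 
      "m \<in> V" "d w m + d m x = d w x" "d w m + d m y = d w y" "d x m + d m y = d x y"
      "n \<in> V" "d w n + d n y = d w y" "d w n + d n z = d w z" "d y n + d n z = d y z"
      "d w m \<le> d w n"
    for x y z w m n
  proof -
    obtain p where p: "p \<in> V" "d w p = d w m" "d w p + d p n = d w n"
      using point_at_distance[OF H(4,9,13)] by metis
    have "d w p + d p y = d w y"
      using dist_triangle[of p n y] dist_triangle[of w p y] p H by auto
    then have "p = m" using point_between_unique[of w y p m] p H by auto
    moreover have "d x z \<le> d x m + d m z" "d m z \<le> d m n + d n z"
      using dist_triangle H by auto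
    ultimately show ?thesis using p H dist_sym[of n y] dist_sym[of x m] dist_sym[of y w] by auto
  qed
  obtain m where m: "m \<in> V" "d w m + d m x = d w x" "d w m + d m z = d w z" "d x m + d m z = d x z"
    using median_exists[of w x z] V by metis
  obtain n where n: "n \<in> V" "d w n + d n z = d w z" "d w n + d n y = d w y" "d z n + d n y = d z y"
    using median_exists[of w z y] V by metis
  show ?thesis
  proof (cases "d w m \<le> d w n")
    case True
    from key[OF V(1,3,2,4) m n True] show ?thesis
      using dist_sym[OF V(3,2)] dist_sym[OF V(4,1)] dist_sym[OF V(4,2)] by linarith
  next
    case False
    then have "d w n \<le> d w m" by simp
    have "d z n + d n y = d z y" "d z m + d m x = d z x"
      using m n dist_sym[OF V(1,3)] dist_sym[of x m] dist_sym[of m z] V by auto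
    then have "d y x + d z w \<le> d y z + d w x \<or> d y x + d w z \<le> d z x + d w y"
      using key[of y z x w n m] V m n \<open>d w n \<le> d w m\<close>
        dist_sym[of n y] dist_sym[of n z] dist_sym[of z y] dist_sym[of w z] by auto
    then show ?thesis
      using dist_sym[OF V(2,1)] dist_sym[OF V(3,1)] dist_sym[OF V(3,4)] dist_sym[OF V(4,1)]
        dist_sym[OF V(4,2)] dist_sym[OF V(4,3)] by linarith
  qed
qed

text \<open>Two segments that overlap in a nondegenerate piece glue to a segment: of the two
  alternatives in \<open>four_point\<close>, the positive length of the overlap rules one out, and
  the other is the claim.\<close>

lemma local_to_global:
  assumes V: "x \<in> V" "y \<in> V" "z \<in> V" "w \<in> V" and "y \<noteq> z"
    and "d x z = d x y + d y z" "d y w = d y z + d z w"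
  shows "d x w = d x y + d y z + d z w"
proof -
  have "d y z > 0" using dist_eq_0 V \<open>y \<noteq> z\<close> by auto
  then show ?thesis
    using four_point[of x z y w] dist_triangle[of x y w] dist_sym[of z y] assms by auto
qed

text \<open>No branch at \<open>m\<close> contains both endpoints, so \<open>m\<close> lies between
  \<open>z\<close> and at least one of them.\<close>

lemma dist_from_between:
  assumes V: "x \<in> V" "y \<in> V" "m \<in> V" "z \<in> V" and m: "d x m + d m y = d x y"
  shows "d m z + d x m = d x z \<or> d m z + d m y = d y z"
  using four_point[of x y m z] dist_triangle[of x m z] dist_triangle[of y m z]
    dist_triangle[of m x z]  dist_triangle[of m y z]
    dist_sym[of x m] dist_sym[of m y] dist_sym[of x y]  assms by auto

end

section \<open>Convex sets and projections\<close>

context simplicial_tree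
begin

definition tconvex :: "'v set \<Rightarrow> bool" where
  "tconvex A \<longleftrightarrow> A \<subseteq> V \<and> (\<forall>x\<in>A. \<forall>y\<in>A. \<forall>m\<in>V. d x m + d m y = d x y \<longrightarrow> m \<in> A)"

text \<open>Nearest-point projection. The choice is only formal: for nonempty convex
  \<open>A\<close> and \<open>y\<close> in \<open>V\<close> the nearest point is unique.\<close>

definition proj :: "'v set \<Rightarrow> 'v \<Rightarrow> 'v" where
  "proj A y = (SOME a. a \<in> A \<and> (\<forall>b\<in>A. d y a \<le> d y b))"

lemma tconvexD: "tconvex A \<Longrightarrow> x \<in> A \<Longrightarrow> y \<in> A \<Longrightarrow> m \<in> V \<Longrightarrow> d x m + d m y = d x y \<Longrightarrow> m \<in> A"
  unfolding tconvex_def by blast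

lemma tconvex_V: "tconvex A \<Longrightarrow> x \<in> A \<Longrightarrow> x \<in> V"
  unfolding tconvex_def by blast

lemma tconvex_Int: "tconvex A \<Longrightarrow> tconvex B \<Longrightarrow> tconvex (A \<inter> B)"
  unfolding tconvex_def by blast

lemma proj_in_and_min:
  assumes "A \<noteq> {}" shows "proj A y \<in> A \<and> (\<forall>b\<in>A. d y (proj A y) \<le> d y b)"
proof -
  obtain a0 where "a0 \<in> A" using assms by blast
  then have "\<exists>a. a \<in> A \<and> (\<forall>b\<in>A. d y a \<le> d y b)"
    using arg_min_nat_lemma[of "\<lambda>a. a \<in> A" a0 "d y"] by blast
  from someI_ex[OF this] show ?thesis unfolding proj_def .
qed

lemmas proj_in = proj_in_and_min[THEN conjunct1]

lemma proj_V: "tconvex A \<Longrightarrow> A \<noteq> {} \<Longrightarrow> proj A y \<in> V"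
  using proj_in tconvex_V by blast

lemma proj_min: "b \<in> A \<Longrightarrow> d y (proj A y) \<le> d y b"
  using proj_in_and_min by blast

text \<open>The median of \<open>y\<close>, its projection and \<open>b\<close> lies in
  \<open>A\<close> by convexity, hence is not nearer to \<open>y\<close> than the projection, hence
  equals it.\<close>

lemma proj_between:
  assumes A: "tconvex A" and b: "b \<in> A" and y: "y \<in> V"
  shows "d y b = d y (proj A y) + d (proj A y) b"
proof -
  let ?a = "proj A y"
  have a: "?a \<in> A" using b proj_in by blast
  have V: "?a \<in> V" "b \<in> V" using A a b tconvex_V by auto
  obtain m where m: "m \<in> V" "d y ?a = d y m + d m ?a" "d y m + d m b = d y b"
    "d ?a m + d m b = d ?a b"
    using median_exists[of y ?a b] y V by metis
  have "m \<in> A" using tconvexD[OF A a b m(1) m(4)] .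
  then have "d m ?a = 0" using m proj_min[of m A y] by auto
  then have "m = ?a" using dist_eq_0 m V by auto
  then show ?thesis using m by auto
qed

lemma proj_unique:
  assumes A: "tconvex A" and a: "a \<in> A" and y: "y \<in> V" and "\<And>b. b \<in> A \<Longrightarrow> d y a \<le> d y b"
  shows "proj A y = a"
proof -
  have "d (proj A y) a = 0" 
    using proj_between[OF A a y] assms(4)[OF proj_in[of A y]] a by auto
  then show ?thesis using dist_eq_0 a proj_in[of A y] tconvex_V[OF A] by auto
qed

lemma proj_id: "tconvex A \<Longrightarrow> y \<in> A \<Longrightarrow> proj A y = y"
  by (rule proj_unique) (auto simp: tconvex_V)

text \<open>By \<open>proj_between\<close> the geodesic can be traced from either end up to the
  opposite projection; the two pieces overlap in the segment between the projections and glue by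
  \<open>local_to_global\<close>.\<close>

lemma proj_bridge:
  assumes A: "tconvex A" "A \<noteq> {}" and V: "y \<in> V" "u \<in> V" and ne: "proj A y \<noteq> proj A u"
  shows "d y u = d y (proj A y) + d (proj A y) (proj A u) + d (proj A u) u"
proof (rule local_to_global)
  show "d y (proj A u) = d y (proj A y) + d (proj A y) (proj A u)"
    by (rule proj_between) (use assms proj_in in auto)
  have "d u (proj A y) = d u (proj A u) + d (proj A u) (proj A y)"
    by (rule proj_between) (use assms proj_in in auto)
  then show "d (proj A y) u = d (proj A y) (proj A u) + d (proj A u) u"
    using dist_sym proj_V assms by (metis add.commute)
qed (use assms proj_V in auto)

lemma proj_on_segment:
  assumes B: "tconvex B" "B \<noteq> {}" and V: "y \<in> V" "z \<in> V"
    and z: "d y z + d z (proj B y) = d y (proj B y)"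
  shows "proj B z = proj B y"
proof (rule proj_unique)
  fix b assume b: "b \<in> B"
  then have "d y (proj B y) \<le> d y b" by (rule proj_min)
  also have "d y b \<le> d y z + d z b" using dist_triangle V b B tconvex_V by auto
  finally show "d z (proj B y) \<le> d z b" using z by linarith
qed (use assms proj_in in auto)

text \<open>The geodesic from \<open>y\<close> to \<open>B\<close> runs through the projection of \<open>y\<close> to \<open>A\<close>.\<close>

lemma behrstock:
  assumes A: "tconvex A" "A \<noteq> {}" and B: "tconvex B" "B \<noteq> {}" and y: "y \<in> V"
    and far: "proj A y \<notin> proj A ` B"
  shows "proj B y \<in> proj B ` A"
proof -
  let ?q = "proj B y" and ?z = "proj A y"
  have q: "?q \<in> B" using B proj_in by auto
  have "d y ?q = d y ?z + d ?z (proj A ?q) + d (proj A ?q) ?q"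
    by (rule proj_bridge) (use assms q proj_V in auto)
  moreover have "d ?z ?q \<le> d ?z (proj A ?q) + d (proj A ?q) ?q" "d y ?q \<le> d y ?z + d ?z ?q"
    using dist_triangle proj_V assms by auto
  ultimately have "d y ?z + d ?z ?q = d y ?q" by linarith
  then have "proj B ?z = ?q" using proj_on_segment B y proj_V A by metis
  then show ?thesis using proj_in A by (metis imageI)
qed

lemma tconvex_singleton: "v \<in> V \<Longrightarrow> tconvex {v}"
  unfolding tconvex_def by (metis add_is_0 dist_eq_0 dist_self empty_subsetI insert_subset singletonD singletonI)

lemma connected_in_imp_tconvex:
  assumes W: "W \<subseteq> V" "connected_in E W" shows "tconvex W"
  unfolding tconvex_def
proof (intro conjI ballI impI W(1))
  fix x y m assume xy: "x \<in> W" "y \<in> W" and m: "m \<in> V" "d x m + d m y = d x y"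
  show "m \<in> W"
  proof (rule ccontr)
    assume mW: "m \<notin> W"
    text \<open>Walking along an edge that avoids \<open>m\<close> does not change the branch at \<open>m\<close>.\<close>
    have "d x m + d m y > d x y" if "(\<lambda>a b. a \<in> W \<and> b \<in> W \<and> E a b)\<^sup>*\<^sup>* x y" for y
      using that
    proof (induction rule: rtranclp_induct)
      case base
      then show ?case using dist_eq_0[of x m] m xy mW W by auto
    next
      case (step y z)
      have V: "x \<in> V" "y \<in> V" "z \<in> V" "m \<in> V" using step W xy m by auto
      have "d y z = 1" using dist_1_iff V step by auto
      moreover have "d m y > 0" "d m z > 0" using dist_eq_0 V step mW by auto
      ultimately show ?case
        using step.IH four_point[of x z m y] dist_triangle[of m y z] dist_triangle[of x y z]
          dist_triangle[of y z m] dist_sym[of m y] dist_sym[of m z] dist_sym[of z y] V by auto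
    qed
    then show False using W(2) xy m unfolding connected_in_def by fastforce
  qed
qed

lemma tconvex_imp_connected_in:
  assumes W: "tconvex W" shows "connected_in E W"
  unfolding connected_in_def
proof (intro ballI)
  fix x y assume "x \<in> W" "y \<in> W"
  then show "(\<lambda>a b. a \<in> W \<and> b \<in> W \<and> E a b)\<^sup>*\<^sup>* x y"
  proof (induction "d x y" arbitrary: y)
    case 0
    then show ?case using dist_eq_0 tconvex_V[OF W] by auto
  next
    case (Suc n)
    have V: "x \<in> V" "y \<in> V" using Suc tconvex_V[OF W] by auto
    have "n \<le> d x y" using Suc by linarith
    from point_at_distance[OF V this]
    obtain z where z: "z \<in> V" "d x z = n" "d x z + d z y = d x y" .
    have "z \<in> W" using tconvexD[OF W _ _ z(1,3)] Suc by auto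
    moreover have "E z y" using dist_1_iff[of z y] z V Suc by auto
    ultimately show ?case
      using Suc by (auto intro: rtranclp.rtrancl_into_rtrancl[of _ x z y] simp: z)
  qed
qed

text \<open>The median of three points, one in each pairwise intersection, lies in all three
  sets.\<close>

lemma helly3:
  assumes "tconvex A" "tconvex B" "tconvex C" "A \<inter> B \<noteq> {}" "B \<inter> C \<noteq> {}" "A \<inter> C \<noteq> {}"
  shows "A \<inter> B \<inter> C \<noteq> {}"
proof -
  obtain x y z where xyz: "x \<in> A" "x \<in> B" "y \<in> B" "y \<in> C" "z \<in> A" "z \<in> C" using assms by blast
  then have V: "x \<in> V" "y \<in> V" "z \<in> V" using assms tconvex_V by auto
  obtain m where m: "m \<in> V" "d x m + d m y = d x y" "d x m + d m z = d x z" "d y m + d m z = d y z"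
    using median_exists V by metis
  have "m \<in> A" "m \<in> B" "m \<in> C"
    using tconvexD[OF assms(1) xyz(1,5) m(1,3)] tconvexD[OF assms(2) xyz(2,3) m(1,2)]
      tconvexD[OF assms(3) xyz(4,6) m(1,4)] by auto
  then show ?thesis by blast
qed

text \<open>Induction after intersecting every set with the newly added one; \<open>helly3\<close>
  keeps the family pairwise intersecting.\<close>

lemma helly:
  assumes "finite I" "I \<noteq> {}" "\<And>i. i \<in> I \<Longrightarrow> tconvex (C i)"
    "\<And>i j. i \<in> I \<Longrightarrow> j \<in> I \<Longrightarrow> C i \<inter> C j \<noteq> {}"
  shows "(\<Inter>i\<in>I. C i) \<noteq> {}"
  using assms
proof (induction arbitrary: C rule: finite_ne_induct)
  case (singleton i)
  then show ?case by auto
next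
  case (insert i I)
  have "(\<Inter>j\<in>I. C i \<inter> C j) \<noteq> {}"
  proof (rule insert.IH)
    fix j assume "j \<in> I"
    then show "tconvex (C i \<inter> C j)" using insert.prems tconvex_Int by auto
  next
    fix j l assume jl: "j \<in> I" "l \<in> I"
    have "C i \<inter> C j \<inter> C l \<noteq> {}"
      by (rule helly3) (use insert.prems jl in auto)
    then show "(C i \<inter> C j) \<inter> (C i \<inter> C l) \<noteq> {}" by blast
  qed
  then show ?case using insert.hyps by auto
qed

end

section \<open>Elliptic and hyperbolic elements\<close>

context tree_action
begin

sublocale grp: group G
  using group_hom by (rule group_hom.axioms(1))

lemma act_V: "g \<in> carrier G \<Longrightarrow> x \<in> V \<Longrightarrow> \<phi> g x \<in> V"
  using element_image by blast

lemma act_one: "x \<in> V \<Longrightarrow> \<phi> \<one>\<^bsub>G\<^esub> x = x"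
  using id_eq_one by (metis restrict_apply')

lemma act_inv: "g \<in> carrier G \<Longrightarrow> x \<in> V \<Longrightarrow> \<phi> (inv\<^bsub>G\<^esub> g) (\<phi> g x) = x"
  using orbit_sym_aux by blast

lemma act_inv': "g \<in> carrier G \<Longrightarrow> x \<in> V \<Longrightarrow> \<phi> g (\<phi> (inv\<^bsub>G\<^esub> g) x) = x"
  using act_inv[of "inv\<^bsub>G\<^esub> g" x] by auto

lemmas act_mult = composition_rule

lemma walk_act:
  assumes "g \<in> carrier G" "(E ^^ n) x y" "x \<in> V"
  shows "(E ^^ n) (\<phi> g x) (\<phi> g y)"
  using assms(2)
proof (induction n arbitrary: y)
  case 0
  then show ?case by simp
next
  case (Suc n)
  then obtain z where z: "(E ^^ n) x z" "E z y" by (auto elim: relpowp_Suc_E)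
  then have "E (\<phi> g z) (\<phi> g y)" using automorphism[OF assms(1)] adj_V by blast
  then show ?case using Suc.IH[OF z(1)] by (rule relpowp_Suc_I[rotated])
qed

lemma dist_act:
  assumes g: "g \<in> carrier G" and V: "x \<in> V" "y \<in> V"
  shows "d (\<phi> g x) (\<phi> g y) = d x y"
proof -
  have le: "d (\<phi> g x) (\<phi> g y) \<le> d x y" if "g \<in> carrier G" "x \<in> V" "y \<in> V" for g x y
    using dist_le[OF walk_act[OF that(1) dist_walk[OF that(2,3)] that(2)]] .
  show ?thesis
    using le[OF g V] le[of "inv\<^bsub>G\<^esub> g" "\<phi> g x" "\<phi> g y"] g V act_V act_inv by (simp add: le_antisym)
qed

lemma dist_act_inv:
  assumes g: "g \<in> carrier G" and V: "x \<in> V" "y \<in> V"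
  shows "d (\<phi> (inv\<^bsub>G\<^esub> g) x) y = d x (\<phi> g y)"
  using dist_act[of g "\<phi> (inv\<^bsub>G\<^esub> g) x" y] assms act_V act_inv' by simp

lemma proj_act:
  assumes A: "tconvex A" "A \<noteq> {}" and g: "g \<in> carrier G" "\<phi> g ` A = A" and y: "y \<in> V"
  shows "proj A (\<phi> g y) = \<phi> g (proj A y)"
proof (rule proj_unique[OF A(1)])
  show "\<phi> g (proj A y) \<in> A" using g proj_in[OF A(2)] by blast
  fix b assume "b \<in> A"
  then obtain a where "a \<in> A" "b = \<phi> g a" using g by blast
  then show "d (\<phi> g y) (\<phi> g (proj A y)) \<le> d (\<phi> g y) b"
    using dist_act g y proj_V[OF A] proj_min tconvex_V[OF A(1)] by metis
qed (use act_V assms in auto)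

abbreviation tl :: "'g \<Rightarrow> nat" where "tl \<equiv> translation_length V E \<phi>"

lemma tl_le: "x \<in> V \<Longrightarrow> tl g \<le> d x (\<phi> g x)"
  unfolding translation_length_def by (rule cINF_lower) auto

text \<open>An infimum of natural numbers is a minimum. Therefore elliptic elements fix a vertex and
  \<open>axis\<close> below is never empty.\<close>

lemma tl_attained: obtains x where "x \<in> V" "d x (\<phi> g x) = tl g"
proof -
  have "tl g \<in> (\<lambda>v. d v (\<phi> g v)) ` V"
    unfolding translation_length_def using vertices_nonempty by (intro Inf_nat_def1) auto
  then show ?thesis using that by auto
qed

lemma elliptic_iff: assumes "g \<in> carrier G" shows "elliptic V E \<phi> g \<longleftrightarrow> (\<exists>x\<in>V. \<phi> g x = x)"
proof
  assume "elliptic V E \<phi> g"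
  then show "\<exists>x\<in>V. \<phi> g x = x"
    using tl_attained[of g] dist_eq_0 act_V[OF assms] unfolding elliptic_def by metis
next
  assume "\<exists>x\<in>V. \<phi> g x = x"
  then show "elliptic V E \<phi> g" using tl_le[of _ g] unfolding elliptic_def by fastforce
qed

section \<open>Fixed point sets, axes and translation lengths\<close>

definition fix_set :: "'g \<Rightarrow> 'v set" where "fix_set g = {x \<in> V. \<phi> g x = x}"

text \<open>If \<open>x\<close> and \<open>y\<close> are fixed, \<open>m\<close> and its image have
  the same distances to both, so \<open>point_between_unique\<close> identifies them.\<close>

lemma tconvex_fix_set: assumes g: "g \<in> carrier G" shows "tconvex (fix_set g)"
  unfolding tconvex_def
proof (intro conjI ballI impI)
  fix x y m assume H: "x \<in> fix_set g" "y \<in> fix_set g" "m \<in> V" "d x m + d m y = d x y"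
  have V: "x \<in> V" "y \<in> V" using H by (auto simp: fix_set_def)
  have "d x (\<phi> g m) = d x m" "d (\<phi> g m) y = d m y"
    using dist_act[OF g V(1) H(3)] dist_act[OF g H(3) V(2)] H by (auto simp: fix_set_def)
  then have "\<phi> g m = m"
    by (intro point_between_unique[of x y]) (use H V act_V g in auto)
  then show "m \<in> fix_set g" using H by (auto simp: fix_set_def)
qed (auto simp: fix_set_def)

lemma acylindrical_trivial:
  assumes "acylindrical G V E \<phi> k" "c \<in> carrier G" "p \<in> fix_set c" "r \<in> fix_set c" "d p r > k"
  shows "c = \<one>\<^bsub>G\<^esub>"
proof (rule ccontr)
  assume "c \<noteq> \<one>\<^bsub>G\<^esub>"
  moreover have "elliptic V E \<phi> c" using elliptic_iff assms by (auto simp: fix_set_def)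
  ultimately have "tree_diameter E (fixed_points V \<phi> c) \<le> enat k"
    using assms by (auto simp: acylindrical_def)
  moreover have "enat (d p r) \<le> tree_diameter E (fixed_points V \<phi> c)"
    unfolding tree_diameter_def using assms
    by (intro SUP_upper2[of p] SUP_upper) (auto simp: fixed_points_def fix_set_def)
  ultimately have "enat (d p r) \<le> enat k" by (rule order_trans[rotated])
  then show False using assms(5) by simp
qed

definition hyp :: "'g \<Rightarrow> bool" where "hyp g \<longleftrightarrow> g \<in> carrier G \<and> \<not> elliptic V E \<phi> g"

text \<open>The set of minimal displacement, defined for every element. For elliptic elements it is
  the fixed point set; for hyperbolic elements of an action without inversions it is a line, by
  \<open>axis_is_line\<close>.\<close>

definition axis :: "'g \<Rightarrow> 'v set" where "axis g = {x \<in> V. d x (\<phi> g x) = tl g}"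

lemma hyp_carrier: "hyp g \<Longrightarrow> g \<in> carrier G" by (simp add: hyp_def)

lemma hyp_tl_pos: "hyp g \<Longrightarrow> tl g > 0" by (simp add: hyp_def elliptic_def)

lemma hyp_no_fix: "hyp g \<Longrightarrow> x \<in> V \<Longrightarrow> \<phi> g x \<noteq> x"
  using elliptic_iff hyp_def by blast

lemma axis_V: "a \<in> axis g \<Longrightarrow> a \<in> V" by (simp add: axis_def)

lemma axis_dist: "a \<in> axis g \<Longrightarrow> d a (\<phi> g a) = tl g" by (simp add: axis_def)

lemma axis_nonempty: "axis g \<noteq> {}"
  using tl_attained[of g] by (auto simp: axis_def)

text \<open>Displacement is convex along segments. The bound at \<open>m\<close> is linear
  arithmetic over \<open>dist_from_between\<close>, applied to \<open>m\<close> and the image of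
  \<open>m\<close>, and to the image of \<open>m\<close> and each of \<open>p\<close>,
  \<open>q\<close>.\<close>

lemma tconvex_axis: assumes g: "g \<in> carrier G" shows "tconvex (axis g)"
  unfolding tconvex_def
proof (intro conjI ballI impI)
  fix p q m assume H: "p \<in> axis g" "q \<in> axis g" "m \<in> V" "d p m + d m q = d p q"
  have V: "p \<in> V" "q \<in> V" "m \<in> V" "\<phi> g p \<in> V" "\<phi> g q \<in> V" "\<phi> g m \<in> V"
    using H axis_V act_V g by auto
  have iso: "d (\<phi> g p) (\<phi> g m) = d p m" "d (\<phi> g m) (\<phi> g q) = d m q" "d (\<phi> g p) (\<phi> g q) = d p q"
    using dist_act g V by auto
  have disp: "d p (\<phi> g p) = tl g" "d q (\<phi> g q) = tl g" using H axis_dist by auto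
  have 1: "d m (\<phi> g m) + d p m = d p (\<phi> g m) \<or> d m (\<phi> g m) + d m q = d q (\<phi> g m)"
    using dist_from_between[OF V(1,2,3,6) H(4)] .
  have 2: "d (\<phi> g m) p + d p m = d (\<phi> g p) p \<or> d (\<phi> g m) p + d m q = d (\<phi> g q) p"
    using dist_from_between[OF V(4,5,6,1)] iso H(4) by simp
  have 3: "d (\<phi> g m) q + d p m = d (\<phi> g p) q \<or> d (\<phi> g m) q + d m q = d (\<phi> g q) q"
    using dist_from_between[OF V(4,5,6,2)] iso H(4) by simp
  have 4: "d p (\<phi> g q) \<le> tl g + d p q" "d q (\<phi> g p) \<le> d p q + tl g"
    using dist_triangle[OF V(1,4,5)] dist_triangle[OF V(2,1,4)] iso disp dist_sym[OF V(1,2)] by auto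
  have 5: "d (\<phi> g m) p = d p (\<phi> g m)" "d (\<phi> g m) q = d q (\<phi> g m)"
    "d (\<phi> g p) p = d p (\<phi> g p)" "d (\<phi> g q) p = d p (\<phi> g q)" 
    "d (\<phi> g p) q = d q (\<phi> g p)" "d (\<phi> g q) q = d q (\<phi> g q)" using dist_sym V by auto
  have "d m (\<phi> g m) \<le> tl g"
    using 1 2 3 4 disp H(4) unfolding 5 by linarith
  then show "m \<in> axis g" using tl_le[OF V(3), of g] V(3) by (simp add: axis_def)
qed (auto simp: axis_def)

lemma tl_conj_le:
  assumes "g \<in> carrier G" "h \<in> carrier G"
  shows "tl (h \<otimes>\<^bsub>G\<^esub> g \<otimes>\<^bsub>G\<^esub> inv\<^bsub>G\<^esub> h) \<le> tl g"
proof -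
  obtain x where x: "x \<in> V" "d x (\<phi> g x) = tl g" using tl_attained by blast
  have "d (\<phi> h x) (\<phi> (h \<otimes>\<^bsub>G\<^esub> g \<otimes>\<^bsub>G\<^esub> inv\<^bsub>G\<^esub> h) (\<phi> h x)) = tl g"
    using assms x by (simp add: act_mult act_V act_inv dist_act)
  then show ?thesis using tl_le act_V assms x by metis
qed

lemma tl_conj:
  assumes "g \<in> carrier G" "h \<in> carrier G"
  shows "tl (h \<otimes>\<^bsub>G\<^esub> g \<otimes>\<^bsub>G\<^esub> inv\<^bsub>G\<^esub> h) = tl g"
proof -
  have "inv\<^bsub>G\<^esub> h \<otimes>\<^bsub>G\<^esub> (h \<otimes>\<^bsub>G\<^esub> g \<otimes>\<^bsub>G\<^esub> inv\<^bsub>G\<^esub> h) \<otimes>\<^bsub>G\<^esub> inv\<^bsub>G\<^esub> (inv\<^bsub>G\<^esub> h) = g"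
    using assms by (simp add: grp.m_assoc grp.inv_solve_left')
  then show ?thesis
    using tl_conj_le[OF assms] tl_conj_le[of "h \<otimes>\<^bsub>G\<^esub> g \<otimes>\<^bsub>G\<^esub> inv\<^bsub>G\<^esub> h" "inv\<^bsub>G\<^esub> h"] assms by simp
qed

lemma hyp_conj:
  assumes "hyp g" "h \<in> carrier G" shows "hyp (h \<otimes>\<^bsub>G\<^esub> g \<otimes>\<^bsub>G\<^esub> inv\<^bsub>G\<^esub> h)"
  using assms tl_conj[of g h] by (auto simp: hyp_def elliptic_def)

lemma dist_inv_disp:
  assumes "g \<in> carrier G" "x \<in> V" shows "d x (\<phi> (inv\<^bsub>G\<^esub> g) x) = d x (\<phi> g x)"
  using dist_act_inv[OF assms(1,2,2)] dist_sym[of x "\<phi> (inv\<^bsub>G\<^esub> g) x"] assms act_V by auto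

lemma tl_inv: "g \<in> carrier G \<Longrightarrow> tl (inv\<^bsub>G\<^esub> g) = tl g"
  unfolding translation_length_def by (auto simp: dist_inv_disp intro!: INF_cong)

lemma axis_inv: "g \<in> carrier G \<Longrightarrow> axis (inv\<^bsub>G\<^esub> g) = axis g"
  by (auto simp: axis_def tl_inv dist_inv_disp)

lemma axis_conj_mem:
  assumes "g \<in> carrier G" "h \<in> carrier G" "a \<in> axis g"
  shows "\<phi> h a \<in> axis (h \<otimes>\<^bsub>G\<^esub> g \<otimes>\<^bsub>G\<^esub> inv\<^bsub>G\<^esub> h)"
  using assms by (simp add: axis_def tl_conj act_mult act_V act_inv dist_act)

lemma image_eqI_inv:
  assumes h: "h \<in> carrier G" "A \<subseteq> V"
    and "\<And>a. a \<in> A \<Longrightarrow> \<phi> h a \<in> A" "\<And>a. a \<in> A \<Longrightarrow> \<phi> (inv\<^bsub>G\<^esub> h) a \<in> A"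
  shows "\<phi> h ` A = A"
proof
  show "A \<subseteq> \<phi> h ` A"
  proof
    fix a assume a: "a \<in> A"
    then have "a = \<phi> h (\<phi> (inv\<^bsub>G\<^esub> h) a)" using act_inv' h by auto
    then show "a \<in> \<phi> h ` A" using assms(4)[OF a] by blast
  qed
qed (use assms in auto)

lemma image_inv_mem:
  assumes "h \<in> carrier G" "A \<subseteq> V" "\<phi> h ` A = A" "a \<in> A" shows "\<phi> (inv\<^bsub>G\<^esub> h) a \<in> A"
proof -
  obtain b where "b \<in> A" "a = \<phi> h b" using assms by blast
  then show ?thesis using act_inv assms by auto
qed

lemma conj_conj_inv:
  assumes "g \<in> carrier G" "h \<in> carrier G"
  shows "inv\<^bsub>G\<^esub> h \<otimes>\<^bsub>G\<^esub> (h \<otimes>\<^bsub>G\<^esub> g \<otimes>\<^bsub>G\<^esub> inv\<^bsub>G\<^esub> h) \<otimes>\<^bsub>G\<^esub> h = g"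
proof -
  have "inv\<^bsub>G\<^esub> h \<otimes>\<^bsub>G\<^esub> (h \<otimes>\<^bsub>G\<^esub> g \<otimes>\<^bsub>G\<^esub> inv\<^bsub>G\<^esub> h) \<otimes>\<^bsub>G\<^esub> h
      = (inv\<^bsub>G\<^esub> h \<otimes>\<^bsub>G\<^esub> h) \<otimes>\<^bsub>G\<^esub> g \<otimes>\<^bsub>G\<^esub> (inv\<^bsub>G\<^esub> h \<otimes>\<^bsub>G\<^esub> h)"
    using assms by (simp only: grp.m_assoc grp.m_closed grp.inv_closed)
  then show ?thesis using assms by simp
qed

text \<open>Conjugating by \<open>h\<close> moves the axis by \<open>h\<close>, and inverting an
  element does not change its axis. The contrapositive recognises a conjugate that is neither
  \<open>g\<close> nor its inverse.\<close>

lemma conj_eq_imp_axis_image: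
  assumes g: "g \<in> carrier G" and h: "h \<in> carrier G"
    and "h \<otimes>\<^bsub>G\<^esub> g \<otimes>\<^bsub>G\<^esub> inv\<^bsub>G\<^esub> h = g \<or> h \<otimes>\<^bsub>G\<^esub> g \<otimes>\<^bsub>G\<^esub> inv\<^bsub>G\<^esub> h = inv\<^bsub>G\<^esub> g"
  shows "\<phi> h ` axis g = axis g"
proof (rule image_eqI_inv[OF h])
  have "inv\<^bsub>G\<^esub> h \<otimes>\<^bsub>G\<^esub> g \<otimes>\<^bsub>G\<^esub> h = g \<or> inv\<^bsub>G\<^esub> h \<otimes>\<^bsub>G\<^esub> g \<otimes>\<^bsub>G\<^esub> h = inv\<^bsub>G\<^esub> g"
    using assms(3)
  proof
    assume "h \<otimes>\<^bsub>G\<^esub> g \<otimes>\<^bsub>G\<^esub> inv\<^bsub>G\<^esub> h = g"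
    then show ?thesis using conj_conj_inv[OF g h] by simp
  next
    assume "h \<otimes>\<^bsub>G\<^esub> g \<otimes>\<^bsub>G\<^esub> inv\<^bsub>G\<^esub> h = inv\<^bsub>G\<^esub> g"
    then have "inv\<^bsub>G\<^esub> h \<otimes>\<^bsub>G\<^esub> inv\<^bsub>G\<^esub> g \<otimes>\<^bsub>G\<^esub> h = g" using conj_conj_inv[OF g h] by simp
    then have "inv\<^bsub>G\<^esub> (inv\<^bsub>G\<^esub> h \<otimes>\<^bsub>G\<^esub> inv\<^bsub>G\<^esub> g \<otimes>\<^bsub>G\<^esub> h) = inv\<^bsub>G\<^esub> g" by simp
    then show ?thesis using g h by (simp add: grp.inv_mult_group grp.m_assoc)
  qed
  then show "\<phi> (inv\<^bsub>G\<^esub> h) a \<in> axis g" if "a \<in> axis g" for a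
    using axis_conj_mem[of g "inv\<^bsub>G\<^esub> h" a] axis_inv g h that by auto
  show "\<phi> h a \<in> axis g" if "a \<in> axis g" for a
    using axis_conj_mem[of g h a] axis_inv g h that assms(3) by auto
qed (auto simp: axis_def)

lemma commute_conj:
  assumes "g \<in> carrier G" "h \<in> carrier G" "h \<otimes>\<^bsub>G\<^esub> g = g \<otimes>\<^bsub>G\<^esub> h"
  shows "h \<otimes>\<^bsub>G\<^esub> g \<otimes>\<^bsub>G\<^esub> inv\<^bsub>G\<^esub> h = g"
  using assms by (simp add: grp.m_assoc)

lemma axis_image_self: "g \<in> carrier G \<Longrightarrow> \<phi> g ` axis g = axis g"
  by (intro conj_eq_imp_axis_image) (simp_all add: commute_conj)

text \<open>If the segments from \<open>\<phi> g x\<close> to \<open>x\<close> and to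
  \<open>\<phi> g (\<phi> g x)\<close> had a first edge in common, leading to \<open>u\<close>, then
  for translation length 1 the element \<open>g\<close> would invert that edge. For larger
  translation length, the preimage \<open>?w\<close> of \<open>u\<close> is the neighbour of
  \<open>x\<close> on the segment from \<open>x\<close> to \<open>\<phi> g x\<close>, and
  \<open>u\<close> is the neighbour of its other end, so \<open>?w\<close> would be displaced by
  less than \<open>tl g\<close>.\<close>

lemma axis_aligned:
  assumes ni: "without_inversions G E \<phi>" and g: "hyp g" and x: "x \<in> axis g"
  shows "d x (\<phi> g (\<phi> g x)) = 2 * tl g"
proof -
  let ?y = "\<phi> g x" and ?z = "\<phi> g (\<phi> g x)" and ?t = "tl g"
  have gc: "g \<in> carrier G" using hyp_carrier g .
  have V: "x \<in> V" "?y \<in> V" "?z \<in> V" using x axis_V act_V gc by auto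
  have D: "d x ?y = ?t" "d ?y ?z = ?t" using axis_dist x dist_act gc V by auto
  have pos: "?t > 0" using hyp_tl_pos g .
  obtain m where m: "m \<in> V" "d ?y m + d m x = d ?y x" "d ?y m + d m ?z = d ?y ?z"
    "d x m + d m ?z = d x ?z" using median_exists[of ?y x ?z] V by metis
  have "m = ?y"
  proof (rule ccontr)
    assume "m \<noteq> ?y"
    then have "1 \<le> d ?y m" using dist_eq_0[of ?y m] V m by auto
    from point_at_distance[OF V(2) m(1) this]
    obtain u where u: "u \<in> V" "d ?y u = 1" "d ?y u + d u m = d ?y m" .
    have ux: "1 + d u x = ?t" "1 + d u ?z = ?t"
      using u m D dist_sym[of x ?y] dist_triangle[of u m x] dist_triangle[of u m ?z]
        dist_triangle[of ?y u x] dist_triangle[of ?y u ?z] V by auto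
    let ?w = "\<phi> (inv\<^bsub>G\<^esub> g) u"
    have w: "?w \<in> V" "d x ?w = 1" "1 + d ?w ?y = ?t" "\<phi> g ?w = u"
      using u ux act_V gc dist_act_inv[OF gc u(1) V(1)] dist_sym[of x ?w] dist_sym[of u ?y]
        dist_act_inv[OF gc u(1) V(2)] act_inv' V by auto
    show False
    proof (cases "?t = 1")
      case True
      then have "u = x" "u = ?z" using ux dist_eq_0 V u by auto
      moreover have "E x ?y" using dist_1_iff V D True by auto
      ultimately show False using ni gc unfolding without_inversions_def by metis
    next
      case False
      have "d ?w u + ?t \<le> d ?w x + d u ?y \<or> d ?w u + ?t \<le> d ?w ?y + d u x"
        using four_point[of ?w u x ?y] V u w D by auto
      then have "d ?w u < ?t"
        using w u ux False pos dist_sym[of ?w x] dist_sym[of u ?y] V by auto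
      then show False using tl_le[of ?w g] w by auto
    qed
  qed
  then show ?thesis using m D by auto
qed

lemma act_pow_Suc:
  assumes "g \<in> carrier G" "x \<in> V"
  shows "\<phi> (g [^]\<^bsub>G\<^esub> Suc n) x = \<phi> g (\<phi> (g [^]\<^bsub>G\<^esub> n) x)"
  using act_mult[OF assms(2,1) grp.nat_pow_closed[OF assms(1)], of n] grp.nat_pow_Suc2[OF assms(1), of n]
  by simp

text \<open>The segment from \<open>x\<close> to its second translate and the segment from the first
  to the \<open>n\<close>-th translate overlap in a nondegenerate segment and glue by
  \<open>local_to_global\<close>. This uses the claim for both \<open>n - 1\<close> and
  \<open>n - 2\<close>.\<close>

lemma dist_axis_pow:
  assumes ni: "without_inversions G E \<phi>" and g: "hyp g" and x: "x \<in> axis g"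
  shows "d x (\<phi> (g [^]\<^bsub>G\<^esub> n) x) = n * tl g"
proof (induction n rule: less_induct)
  case (less n)
  have gc: "g \<in> carrier G" using hyp_carrier g .
  note xV = axis_V[OF x]
  consider "n = 0" | "n = 1" | m where "n = Suc (Suc m)"
    by (metis One_nat_def not0_implies_Suc)
  then show ?case
  proof cases
    case 1
    then show ?thesis using act_one xV by simp
  next
    case 2
    then show ?thesis using x gc by (simp add: axis_dist)
  next
    case (3 m)
    let ?y = "\<phi> g x" and ?z = "\<phi> g (\<phi> g x)" and ?w = "\<phi> (g [^]\<^bsub>G\<^esub> n) x"
    have V: "x \<in> V" "?y \<in> V" "?z \<in> V" "?w \<in> V" using xV act_V gc by auto
    have w1: "?w = \<phi> g (\<phi> (g [^]\<^bsub>G\<^esub> Suc m) x)"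
      and w2: "?w = \<phi> g (\<phi> g (\<phi> (g [^]\<^bsub>G\<^esub> m) x))"
      unfolding 3 act_pow_Suc[OF gc xV] by simp_all
    have D: "d x ?y = tl g" "d ?y ?z = tl g" using axis_dist x dist_act gc V by auto
    have "d ?y ?w = Suc m * tl g"
      unfolding w1 using less.IH[of "Suc m"] dist_act gc xV act_V 3 by auto
    moreover have "d ?z ?w = m * tl g"
      unfolding w2 using less.IH[of m] dist_act gc xV act_V 3 by auto
    ultimately show ?thesis
      using local_to_global[of x ?y ?z ?w] axis_aligned[OF ni g x] D V hyp_no_fix[OF g V(2)] 3
      by auto
  qed
qed

end

section \<open>Powers along an axis, invariant subtrees and consequences of acylindricity\<close>

context tree_action
begin

lemma pow_image_mem:
  assumes "g \<in> carrier G" "B \<subseteq> V" "\<phi> g ` B = B" "b \<in> B"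
  shows "\<phi> (g [^]\<^bsub>G\<^esub> (n::nat)) b \<in> B"
proof (induction n)
  case 0
  then show ?case using act_one assms by auto
next
  case (Suc n)
  have "\<phi> g (\<phi> (g [^]\<^bsub>G\<^esub> n) b) \<in> B" using Suc assms(3) by blast
  then show ?case using act_pow_Suc assms by (metis subsetD)
qed

lemma image_inv:
  assumes "h \<in> carrier G" "A \<subseteq> V" "\<phi> h ` A = A"
  shows "\<phi> (inv\<^bsub>G\<^esub> h) ` A = A"
proof (rule image_eqI_inv)
  show "\<phi> (inv\<^bsub>G\<^esub> (inv\<^bsub>G\<^esub> h)) a \<in> A" if "a \<in> A" for a
    using that assms by auto
qed (use assms image_inv_mem[OF assms] in auto)

lemma pow_image:
  assumes "g \<in> carrier G" "B \<subseteq> V" "\<phi> g ` B = B"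
  shows "\<phi> (g [^]\<^bsub>G\<^esub> (n::nat)) ` B = B"
proof (rule image_eqI_inv)
  have inv: "\<phi> (inv\<^bsub>G\<^esub> g) ` B = B"
    using image_inv[OF assms] .
  show "\<phi> (inv\<^bsub>G\<^esub> (g [^]\<^bsub>G\<^esub> n)) b \<in> B" if "b \<in> B" for b
    using pow_image_mem[OF _ assms(2) inv that, of n] assms by (simp add: grp.nat_pow_inv)
qed (use assms pow_image_mem in auto)

context
  assumes ni: "without_inversions G E \<phi>"
begin

text \<open>On a line with \<open>p\<close> at 0, \<open>a\<close> at s and \<open>h n\<close>
  translating by T = \<open>n * tl g\<close>, the distances in question are
  \<open>\<bar>s + T\<bar>\<close> and \<open>\<bar>s - T\<bar>\<close>, and the three claims are
  evident. Since \<open>axis g\<close> is not yet known to be a line, they are extracted from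
  \<open>four_point\<close> and \<open>dist_axis_pow\<close> instead.\<close>

lemma axis_pow_positions:
  assumes g: "hyp g" and p: "p \<in> axis g" and a: "a \<in> axis g"
  defines "h n \<equiv> g [^]\<^bsub>G\<^esub> (n::nat)"
  shows "d p a + n * tl g = d p (\<phi> (h n) a) \<or> d p a + n * tl g = d (\<phi> (h n) p) a"
    and "d p a \<le> n * tl g \<Longrightarrow> d p (\<phi> (h n) a) + d (\<phi> (h n) p) a = 2 * n * tl g"
    and "n * tl g \<le> d p a \<Longrightarrow> d p (\<phi> (h n) a) + d (\<phi> (h n) p) a = 2 * d p a"
proof -
  have gc: "g \<in> carrier G" using hyp_carrier g .
  then have hc: "h n \<in> carrier G" by (simp add: h_def)
  let ?q = "\<phi> (h n) p" and ?b = "\<phi> (h n) a" and ?r = "\<phi> (inv\<^bsub>G\<^esub> (h n)) p"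
  have V: "p \<in> V" "a \<in> V" "?q \<in> V" "?b \<in> V" "?r \<in> V" using p a axis_V act_V hc by auto
  have D: "d p ?q = n * tl g" "d a ?b = n * tl g"
    unfolding h_def using dist_axis_pow[OF ni g] p a by auto
  have "d ?r ?q = d p (\<phi> (h n \<otimes>\<^bsub>G\<^esub> h n) p)"
    using dist_act_inv hc V by (simp add: act_mult)
  also have "\<dots> = (n + n) * tl g"
    using dist_axis_pow[OF ni g p, of "n + n"] gc by (simp add: h_def grp.nat_pow_mult)
  finally have rq: "d ?r ?q = (n + n) * tl g" .
  have rp: "d ?r p = n * tl g" using dist_act_inv[OF hc V(1,1)] D by simp
  have ra: "d ?r a = d p ?b" using dist_act_inv[OF hc V(1,2)] .
  have "d ?r p + d p ?q = d ?r ?q" using rp D rq by (simp add: add_mult_distrib)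
  from dist_from_between[OF V(5,3,1,2) this]
  show 1: "d p a + n * tl g = d p ?b \<or> d p a + n * tl g = d ?q a"
    using rp ra D by simp
  have iso: "d ?q ?b = d p a" using dist_act hc V by auto
  have 2: "d p a + d p a \<le> n * tl g + n * tl g \<or> d p a + d p a \<le> d p ?b + d ?q a"
    using four_point[of p a ?q ?b] V D iso dist_sym[of a ?q] by auto
  have 3: "n * tl g + n * tl g \<le> d p a + d p a \<or> n * tl g + n * tl g \<le> d p ?b + d ?q a"
    using four_point[of p ?q a ?b] V D iso by auto
  have 4: "d p ?b + d ?q a \<le> n * tl g + n * tl g \<or> d p ?b + d ?q a \<le> d p a + d p a"
    using four_point[OF V(1,4,3,2)] D iso dist_sym[OF V(2,4)] dist_sym[OF V(3,4)] by linarith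
  have 5: "2 * n * tl g = n * tl g + n * tl g" by (simp add: add_mult_distrib)
  show "d p a \<le> n * tl g \<Longrightarrow> d p ?b + d ?q a = 2 * n * tl g"
    unfolding 5 using 1 2 3 4 by linarith
  show "n * tl g \<le> d p a \<Longrightarrow> d p ?b + d ?q a = 2 * d p a"
    using 1 2 3 4 by linarith
qed

text \<open>Every point of the axis lies between two opposite translates of \<open>p\<close>. Hence
  convex sets that contain the orbit of \<open>p\<close> contain the axis, and these translates can
  serve as endpoints for coordinates.\<close>

lemma axis_between_pow:
  assumes g: "hyp g" and p: "p \<in> axis g" and a: "a \<in> axis g" and n: "d p a \<le> n * tl g"
  defines "h \<equiv> g [^]\<^bsub>G\<^esub> (n::nat)"
  shows "d (\<phi> (inv\<^bsub>G\<^esub> h) p) a + d a (\<phi> h p) = 2 * n * tl g"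
    and "d (\<phi> (inv\<^bsub>G\<^esub> h) p) (\<phi> h p) = 2 * n * tl g"
proof -
  have gc: "g \<in> carrier G" using hyp_carrier g .
  then have hc: "h \<in> carrier G" by (simp add: h_def)
  have V: "p \<in> V" "a \<in> V" using p a axis_V by auto
  show "d (\<phi> (inv\<^bsub>G\<^esub> h) p) a + d a (\<phi> h p) = 2 * n * tl g"
    using axis_pow_positions(2)[OF g p a n] dist_act_inv[OF hc V] dist_sym[of a "\<phi> h p"] V act_V[OF hc]
    by (simp add: h_def)
  have "d (\<phi> (inv\<^bsub>G\<^esub> h) p) (\<phi> h p) = d p (\<phi> (h \<otimes>\<^bsub>G\<^esub> h) p)"
    using dist_act_inv hc V act_V by (simp add: act_mult)
  also have "\<dots> = (n + n) * tl g"
    using dist_axis_pow[OF ni g p, of "n + n"] gc by (simp add: h_def grp.nat_pow_mult)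
  finally show "d (\<phi> (inv\<^bsub>G\<^esub> h) p) (\<phi> h p) = 2 * n * tl g" by simp
qed

text \<open>For \<open>w\<close> in \<open>B\<close> the segment from \<open>w\<close> to its image
  runs through the projection \<open>b\<close> of \<open>w\<close> to the axis, because
  \<open>b\<close> and its image are different. So \<open>b\<close> is in \<open>B\<close>, and with
  it the orbit of \<open>b\<close>, between whose points all of the axis lies.\<close>

lemma axis_subset_invariant:
  assumes g: "hyp g" and B: "tconvex B" "B \<noteq> {}" "\<phi> g ` B = B"
  shows "axis g \<subseteq> B"
proof
  have gc: "g \<in> carrier G" using hyp_carrier g .
  have A: "tconvex (axis g)" "axis g \<noteq> {}" "\<phi> g ` axis g = axis g"
    using tconvex_axis gc axis_nonempty axis_image_self by auto
  have BV: "B \<subseteq> V" using B(1) tconvex_V by auto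
  obtain w where w: "w \<in> B" using B by blast
  define b where "b = proj (axis g) w"
  have V: "w \<in> V" "\<phi> g w \<in> V" "b \<in> V" "\<phi> g b \<in> V"
    using w BV act_V gc proj_V[OF A(1,2)] by (auto simp: b_def)
  have pg: "proj (axis g) (\<phi> g w) = \<phi> g b" unfolding b_def using proj_act A gc V by auto
  have "d w (\<phi> g w) = d w b + d b (\<phi> g b) + d (\<phi> g b) (\<phi> g w)"
    using proj_bridge[OF A(1,2) V(1,2)] pg hyp_no_fix[OF g V(3)] unfolding b_def by metis
  moreover have "d b (\<phi> g w) \<le> d b (\<phi> g b) + d (\<phi> g b) (\<phi> g w)"
    "d w (\<phi> g w) \<le> d w b + d b (\<phi> g w)" using dist_triangle V by auto
  ultimately have "d w b + d b (\<phi> g w) = d w (\<phi> g w)" by linarith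
  then have bB: "b \<in> B" using tconvexD[OF B(1) w _ V(3)] B(3) w by blast
  have bA: "b \<in> axis g" unfolding b_def by (rule proj_in[OF A(2)])
  fix a assume a: "a \<in> axis g"
  define n where "n = d b a"
  have "n \<le> n * tl g" using hyp_tl_pos[OF g] by simp
  then have le: "d b a \<le> n * tl g" by (simp add: n_def)
  have "\<phi> (g [^]\<^bsub>G\<^esub> n) b \<in> B" "\<phi> (inv\<^bsub>G\<^esub> (g [^]\<^bsub>G\<^esub> n)) b \<in> B"
    using pow_image_mem[OF gc BV B(3) bB] image_inv_mem[OF _ BV pow_image[OF gc BV B(3)] bB] gc
    by auto
  then show "a \<in> B"
    using tconvexD[OF B(1), of "\<phi> (inv\<^bsub>G\<^esub> (g [^]\<^bsub>G\<^esub> n)) b" "\<phi> (g [^]\<^bsub>G\<^esub> n) b" a]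
      axis_between_pow[OF g bA a le] axis_V[OF a] by simp
qed

text \<open>Both elements push \<open>p\<close> by \<open>t\<close> towards \<open>q\<close>, so
  they agree at \<open>p\<close>, and their inverses agree at \<open>q\<close>. Therefore
  \<open>inv b \<otimes> a\<close> fixes \<open>p\<close> and \<open>?r\<close>, whose distance is
  that of \<open>p\<close> and \<open>q\<close> minus \<open>t\<close>, hence more than
  \<open>k\<close>.\<close>

lemma same_direction_eq:
  assumes acyl: "acylindrical G V E \<phi> k" and ab: "a \<in> carrier G" "b \<in> carrier G"
    and V: "p \<in> V" "q \<in> V"
    and a: "d p (\<phi> a p) = t" "d q (\<phi> a q) = t" "d (\<phi> a p) q + t = d p q"
    and b: "d p (\<phi> b p) = t" "d q (\<phi> b q) = t" "d (\<phi> b p) q + t = d p q"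
    and k: "d p q > t + k"
  shows "a = b"
proof -
  let ?r = "\<phi> (inv\<^bsub>G\<^esub> a) q"
  have ends: "\<phi> a p = \<phi> b p"
    by (rule point_between_unique[of p q]) (use a b ab V act_V in \<open>simp_all add: add.commute\<close>)
  have ra: "d p (\<phi> (inv\<^bsub>G\<^esub> c) q) = d (\<phi> c p) q" "d (\<phi> (inv\<^bsub>G\<^esub> c) q) q = d q (\<phi> c q)"
    if "c \<in> carrier G" for c
    using dist_act_inv[OF that V(2,1)] dist_act_inv[OF that V(2,2)] that
      dist_sym[OF V(1) act_V[OF grp.inv_closed[OF that] V(2)]] dist_sym[OF act_V[OF that V(1)] V(2)]
    by simp_all
  have "?r = \<phi> (inv\<^bsub>G\<^esub> b) q"
    by (rule point_between_unique[of p q])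
       (use a b ab V act_V ra[OF ab(1)] ra[OF ab(2)] in simp_all)
  then have r: "\<phi> b ?r = q" using act_inv' ab V by simp
  define c where "c = inv\<^bsub>G\<^esub> b \<otimes>\<^bsub>G\<^esub> a"
  have c: "c \<in> carrier G" using ab by (simp add: c_def)
  have rV: "?r \<in> V" using act_V ab V by auto
  have "\<phi> c p = p" using ends ab V act_mult[of p "inv\<^bsub>G\<^esub> b" a] act_inv by (simp add: c_def)
  moreover have "\<phi> c ?r = ?r"
    using r ab V rV act_mult[of ?r "inv\<^bsub>G\<^esub> b" a] act_inv[OF ab(2) rV] act_inv'[OF ab(1) V(2)] 
    by (simp add: c_def)
  moreover have "d p ?r > k" using ra[OF ab(1)] a k by simp
  ultimately have "c = \<one>\<^bsub>G\<^esub>"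
    using acylindrical_trivial[OF acyl c, of p ?r] V rV by (simp add: fix_set_def)
  then show ?thesis using ab by (metis c_def grp.inv_closed grp.inv_equality grp.inv_inv)
qed

text \<open>After replacing each element by its inverse if necessary, both translate from
  \<open>p\<close> towards \<open>q\<close>, and \<open>same_direction_eq\<close> applies.\<close>

lemma overlap_eq_or_inv:
  assumes acyl: "acylindrical G V E \<phi> k" and ab: "hyp a" "hyp b" and t: "tl a = tl b"
    and p: "p \<in> axis a" "p \<in> axis b" and q: "q \<in> axis a" "q \<in> axis b" and k: "d p q > tl a + k"
  shows "a = b \<or> a = inv\<^bsub>G\<^esub> b"
proof -
  have V: "p \<in> V" "q \<in> V" using p q axis_V by auto
  have dir: "\<exists>c'\<in>{c, inv\<^bsub>G\<^esub> c}. d (\<phi> c' p) q + tl a = d p q"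
    if c: "hyp c" "p \<in> axis c" "q \<in> axis c" "tl c = tl a" for c
  proof -
    have "d p q + tl a = d p (\<phi> c q) \<or> d p q + tl a = d (\<phi> c p) q"
      "d p (\<phi> c q) + d (\<phi> c p) q = 2 * d p q"
      using axis_pow_positions(1)[OF c(1-3), of 1] axis_pow_positions(3)[OF c(1-3), of 1] c k
        hyp_carrier[OF c(1)] by auto
    then have "d (\<phi> c p) q + tl a = d p q \<or> d p (\<phi> c q) + tl a = d p q" by linarith
    then show ?thesis using dist_act_inv[OF hyp_carrier[OF c(1)] V] by auto
  qed
  obtain a' where a': "a' \<in> {a, inv\<^bsub>G\<^esub> a}" "d (\<phi> a' p) q + tl a = d p q"
    using dir[OF ab(1) p(1) q(1)] by blast
  obtain b' where b': "b' \<in> {b, inv\<^bsub>G\<^esub> b}" "d (\<phi> b' p) q + tl a = d p q"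
    using dir[OF ab(2) p(2) q(2)] t by auto
  have c: "a \<in> carrier G" "b \<in> carrier G" using ab hyp_carrier by auto
  have "a' \<in> carrier G" "b' \<in> carrier G" using a' b' c by auto
  moreover have "d p (\<phi> a' p) = tl a" "d q (\<phi> a' q) = tl a"
    using a' dist_inv_disp[OF c(1)] V axis_dist p q by auto
  moreover have "d p (\<phi> b' p) = tl a" "d q (\<phi> b' q) = tl a"
    using b' dist_inv_disp[OF c(2)] V axis_dist p q t by auto
  ultimately have "a' = b'" using same_direction_eq[OF acyl _ _ V, of a' b' "tl a"] a' b' k by blast
  then show ?thesis using a' b' c by (metis empty_iff grp.inv_inv insert_iff)
qed

text \<open>If \<open>c\<close> is elliptic, \<open>a\<close> preserves its fixed point set, which
  therefore contains the unbounded axis of \<open>a\<close>. If \<open>c\<close> is hyperbolic, it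
  preserves the axes of \<open>a\<close> and \<open>b\<close>, so both contain the axis of
  \<open>c\<close> and their overlap is unbounded.\<close>

lemma commuting_trivial:
  assumes acyl: "acylindrical G V E \<phi> k" and ab: "hyp a" "hyp b" and t: "tl a = tl b"
    and ne: "a \<noteq> b" "a \<noteq> inv\<^bsub>G\<^esub> b"
    and c: "c \<in> carrier G" "c \<otimes>\<^bsub>G\<^esub> a = a \<otimes>\<^bsub>G\<^esub> c" "c \<otimes>\<^bsub>G\<^esub> b = b \<otimes>\<^bsub>G\<^esub> c"
  shows "c = \<one>\<^bsub>G\<^esub>"
proof (cases "elliptic V E \<phi> c")
  case True
  have ac: "a \<in> carrier G" using ab hyp_carrier by auto
  have "\<phi> a ` fix_set c = fix_set c"
  proof (rule image_eqI_inv[OF ac])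
    have *: "\<phi> g x \<in> fix_set c" if "g \<in> carrier G" "c \<otimes>\<^bsub>G\<^esub> g = g \<otimes>\<^bsub>G\<^esub> c" "x \<in> fix_set c" for g x
      using that act_mult[of x c g] act_mult[of x g c] c act_V by (simp add: fix_set_def)
    show "\<phi> a x \<in> fix_set c" if "x \<in> fix_set c" for x using *[OF ac c(2) that] .
    have "c \<otimes>\<^bsub>G\<^esub> inv\<^bsub>G\<^esub> a = inv\<^bsub>G\<^esub> a \<otimes>\<^bsub>G\<^esub> c"
      using c ac by (metis grp.inv_closed grp.inv_solve_left grp.inv_solve_right' grp.m_assoc grp.m_closed)
    then show "\<phi> (inv\<^bsub>G\<^esub> a) x \<in> fix_set c" if "x \<in> fix_set c" for x using *[OF _ _ that] ac by auto
  qed (auto simp: fix_set_def)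
  moreover have "fix_set c \<noteq> {}" using True elliptic_iff c by (auto simp: fix_set_def)
  ultimately have sub: "axis a \<subseteq> fix_set c"
    using axis_subset_invariant[OF ab(1) tconvex_fix_set] c by auto
  obtain p where p: "p \<in> axis a" using axis_nonempty by blast
  let ?q = "\<phi> (a [^]\<^bsub>G\<^esub> Suc k) p"
  have "?q \<in> axis a"
    using pow_image_mem[OF ac _ axis_image_self[OF ac] p] axis_V by blast
  moreover have "Suc k \<le> d p ?q"
    unfolding dist_axis_pow[OF ni ab(1) p]
    using mult_le_mono2[of 1 "tl a" "Suc k"] hyp_tl_pos[OF ab(1)] by simp
  ultimately show ?thesis using acylindrical_trivial[OF acyl c(1), of p ?q] sub p by auto
next
  case False
  then have hc: "hyp c" using c by (simp add: hyp_def)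
  have ac: "a \<in> carrier G" "b \<in> carrier G" using ab hyp_carrier by auto
  have sub: "axis c \<subseteq> axis g" if g: "g \<in> carrier G" "c \<otimes>\<^bsub>G\<^esub> g = g \<otimes>\<^bsub>G\<^esub> c" for g
  proof (rule axis_subset_invariant[OF hc tconvex_axis[OF g(1)] axis_nonempty])
    show "\<phi> c ` axis g = axis g"
      using conj_eq_imp_axis_image[OF g(1) c(1)] commute_conj[OF g(1) c(1) g(2)] by simp
  qed
  obtain p where p: "p \<in> axis c" using axis_nonempty by blast
  let ?n = "Suc (tl a + k)"
  let ?q = "\<phi> (c [^]\<^bsub>G\<^esub> ?n) p"
  have q: "?q \<in> axis c"
    using pow_image_mem[OF c(1) _ axis_image_self[OF c(1)] p] axis_V by blast
  have "?n \<le> d p ?q" 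
    unfolding dist_axis_pow[OF ni hc p] using mult_le_mono2[of 1 "tl c" ?n] hyp_tl_pos[OF hc] by simp
  then have "a = b \<or> a = inv\<^bsub>G\<^esub> b"
    using overlap_eq_or_inv[OF acyl ab t, of p ?q] sub[OF ac(1) c(2)] sub[OF ac(2) c(3)] p q by auto
  then show ?thesis using ne by blast
qed

end

subsection \<open>Existence of hyperbolic elements\<close>

text \<open>The witness is the projection of \<open>v\<close> to the fixed point set. The median of
  it with \<open>v\<close> and \<open>\<phi> t v\<close> is fixed by \<open>t\<close>, as its image
  lies at the same distance on the segment to \<open>\<phi> t v\<close>; being nearest to
  \<open>v\<close>, the projection is this median.\<close>

lemma elliptic_midpoint:
  assumes t: "t \<in> carrier G" "fix_set t \<noteq> {}" and v: "v \<in> V"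
  obtains p where "p \<in> fix_set t" "d v p + d p (\<phi> t v) = d v (\<phi> t v)" "d v (\<phi> t v) = 2 * d v p"
proof -
  let ?F = "fix_set t" and ?u = "\<phi> t v"
  define p where "p = proj ?F v"
  have F: "tconvex ?F" using tconvex_fix_set t by auto
  have pF: "p \<in> ?F" unfolding p_def using proj_in t by auto
  have V: "p \<in> V" "?u \<in> V" using pF act_V t v by (auto simp: fix_set_def)
  have pu: "d p ?u = d p v" using dist_act[OF t(1) V(1) v] pF by (simp add: fix_set_def)
  obtain m where m: "m \<in> V" "d p m + d m v = d p v" "d p m + d m ?u = d p ?u" "d v m + d m ?u = d v ?u"
    using median_exists[of p v ?u] V v by metis
  have mV: "\<phi> t m \<in> V" using act_V t m by auto
  have tm: "d p (\<phi> t m) = d p m" "d (\<phi> t m) ?u = d m v"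
    using dist_act[OF t(1) V(1) m(1)] dist_act[OF t(1) m(1) v] pF by (auto simp: fix_set_def)
  then have "\<phi> t m = m"
    using point_between_unique[OF V(1,2) mV m(1)] m pu by simp
  then have "m \<in> ?F" using m by (simp add: fix_set_def)
  then have "d v p \<le> d v m" unfolding p_def by (rule proj_min)
  then have "d p m = 0" using m dist_sym v V by (metis add_le_same_cancel2 dist_sym le_zero_eq)
  then have "m = p" using dist_eq_0 m V by auto
  then show ?thesis using that[OF pF] m pu dist_sym[of p v] v V by auto
qed

text \<open>If the product fixes \<open>v\<close>, then \<open>t\<close> and the inverse of
  \<open>s\<close> move \<open>v\<close> to the same vertex. By \<open>elliptic_midpoint\<close> the
  midpoint of this displacement is fixed by both.\<close>

lemma common_fixed_point:
  assumes s: "s \<in> carrier G" "fix_set s \<noteq> {}" and t: "t \<in> carrier G" "fix_set t \<noteq> {}"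
    and st: "fix_set (s \<otimes>\<^bsub>G\<^esub> t) \<noteq> {}"
  shows "fix_set s \<inter> fix_set t \<noteq> {}"
proof -
  obtain v where v: "v \<in> V" "\<phi> (s \<otimes>\<^bsub>G\<^esub> t) v = v" using st by (auto simp: fix_set_def)
  have fs: "fix_set (inv\<^bsub>G\<^esub> s) = fix_set s"
    using act_inv[OF s(1)] act_inv'[OF s(1)] by (fastforce simp: fix_set_def)
  have "\<phi> s (\<phi> t v) = v" using v act_mult s t by simp
  then have u: "\<phi> (inv\<^bsub>G\<^esub> s) v = \<phi> t v" using act_inv[OF s(1)] act_V t v by metis
  obtain p where p: "p \<in> fix_set t" "d v p + d p (\<phi> t v) = d v (\<phi> t v)" "d v (\<phi> t v) = 2 * d v p"
    using elliptic_midpoint[OF t v(1)] .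
  obtain q where q: "q \<in> fix_set s" "d v q + d q (\<phi> t v) = d v (\<phi> t v)" "d v (\<phi> t v) = 2 * d v q"
    using elliptic_midpoint[of "inv\<^bsub>G\<^esub> s" v] s v fs u by auto
  have "p = q"
    by (rule point_between_unique[of v "\<phi> t v"]) (use p q v act_V t in \<open>auto simp: fix_set_def\<close>)
  then show ?thesis using p q by auto
qed

lemma fixed_by_generators:
  assumes S: "S \<subseteq> carrier G" "generate G S = carrier G" and v: "v \<in> V" "\<And>s. s \<in> S \<Longrightarrow> \<phi> s v = v"
    and g: "g \<in> carrier G"
  shows "\<phi> g v = v"
proof -
  have "g \<in> generate G S" using S g by simp
  then show ?thesis
  proof (induction rule: generate.induct)
    case one
    then show ?case using act_one v by simp
  next
    case (incl h)
    then show ?case using v by simp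
  next
    case (inv h)
    then show ?case using act_inv[of h v] v S by auto
  next
    case (eng h1 h2)
    then show ?case using act_mult[of v h1 h2] v S by simp
  qed
qed

lemma image_by_generators:
  assumes S: "S \<subseteq> carrier G" "generate G S = carrier G" and A: "A \<subseteq> V" "\<And>s. s \<in> S \<Longrightarrow> \<phi> s ` A = A"
    and g: "g \<in> carrier G"
  shows "\<phi> g ` A = A"
proof -
  have "g \<in> generate G S" using S g by simp
  then show ?thesis
  proof (induction rule: generate.induct)
    case one
    then show ?case using act_one A by (force simp: image_iff)
  next
    case (incl h)
    then show ?case using A by simp
  next
    case (inv h)
    then show ?case
      using image_inv[of h A] A S by auto
  next
    case (eng h1 h2)
    have "\<phi> (h1 \<otimes>\<^bsub>G\<^esub> h2) a = \<phi> h1 (\<phi> h2 a)" if "a \<in> A" for a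
      using act_mult[of a h1 h2] A S eng that by auto
    then have "\<phi> (h1 \<otimes>\<^bsub>G\<^esub> h2) ` A = \<phi> h1 ` \<phi> h2 ` A" by (force simp: image_iff)
    then show ?case using eng by simp
  qed
qed

text \<open>The projection of a globally fixed vertex to \<open>W\<close> is fixed as well, and
  would be an invariant subtree inside \<open>W\<close>.\<close>

lemma no_global_fixed_point:
  assumes W: "minimal_subtree G V E \<phi> W" "\<not> is_point W" and v: "v \<in> V"
    and fixed: "\<And>g. g \<in> carrier G \<Longrightarrow> \<phi> g v = v"
  shows False
proof -
  have W': "W \<subseteq> V" "W \<noteq> {}" "connected_in E W" "\<And>g. g \<in> carrier G \<Longrightarrow> \<phi> g ` W = W"
    using W by (auto simp: minimal_subtree_def invariant_subtree_def subtree_def)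
  then have cW: "tconvex W" using connected_in_imp_tconvex by auto
  define p where "p = proj W v"
  have p: "p \<in> W" using proj_in W' by (auto simp: p_def)
  have "\<phi> g p = p" if "g \<in> carrier G" for g
    using proj_act[OF cW W'(2) that W'(4)[OF that] v] fixed[OF that] by (simp add: p_def)
  then have "invariant_subtree G V E \<phi> {p}"
    using p W' tconvex_imp_connected_in[OF tconvex_singleton[of p]]
    by (auto simp: invariant_subtree_def subtree_def)
  then have "W = {p}" using W p unfolding minimal_subtree_def by blast
  then show False using W(2) by (auto simp: is_point_def)
qed

text \<open>Otherwise the fixed point sets of the generators are nonempty and meet pairwise, so
  \<open>helly\<close> yields a vertex fixed by all generators and hence by
  \<open>G\<close>.\<close>

lemma hyperbolic_exists:
  assumes W: "minimal_subtree G V E \<phi> W" "\<not> is_point W"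
    and S: "finite S" "S \<subseteq> carrier G" "generate G S = carrier G"
  shows "\<exists>h. hyp h \<and> (h \<in> S \<or> (\<exists>s\<in>S. \<exists>t\<in>S. h = s \<otimes>\<^bsub>G\<^esub> t))"
proof (rule ccontr)
  assume not: "\<not> ?thesis"
  have no: "\<not> hyp h" if "h \<in> S \<or> (\<exists>s\<in>S. \<exists>t\<in>S. h = s \<otimes>\<^bsub>G\<^esub> t)" for h
    using not that by blast
  have fx: "fix_set s \<noteq> {}" if "s \<in> S" for s
    using no[of s] that S elliptic_iff by (auto simp: hyp_def fix_set_def)
  have fx2: "fix_set (s \<otimes>\<^bsub>G\<^esub> t) \<noteq> {}" if "s \<in> S" "t \<in> S" for s t
    using no[of "s \<otimes>\<^bsub>G\<^esub> t"] that S elliptic_iff[of "s \<otimes>\<^bsub>G\<^esub> t"]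
    by (auto simp: hyp_def fix_set_def subset_iff)
  have "\<exists>v\<in>V. \<forall>s\<in>S. \<phi> s v = v"
  proof (cases "S = {}")
    case True
    then show ?thesis using vertices_nonempty by auto
  next
    case False
    have "(\<Inter>s\<in>S. fix_set s) \<noteq> {}"
    proof (rule helly[OF S(1) False])
      show "tconvex (fix_set s)" if "s \<in> S" for s using tconvex_fix_set S that by auto
      show "fix_set s \<inter> fix_set t \<noteq> {}" if "s \<in> S" "t \<in> S" for s t
        using common_fixed_point[of s t] fx fx2 S that by blast
    qed
    then show ?thesis using False by (auto simp: fix_set_def)
  qed
  then show False
    using no_global_fixed_point[OF W] fixed_by_generators[OF S(2,3)] by metis
qed

subsection \<open>Axes are lines\<close>

text \<open>The coordinate \<open>pos\<close> is the Busemann function of the repelling end of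
  \<open>h\<close>, normalised to vanish at \<open>w\<close>; it is shown to be an isometry onto the
  integers.\<close>

lemma axis_is_line:
  assumes ni: "without_inversions G E \<phi>" and h: "hyp h"
  shows "is_line E (axis h)"
proof -
  have hc: "h \<in> carrier G" using hyp_carrier h .
  let ?t = "tl h"
  obtain w where w: "w \<in> axis h" using axis_nonempty by blast
  define R where "R n = \<phi> (inv\<^bsub>G\<^esub> (h [^]\<^bsub>G\<^esub> (n::nat))) w" for n
  define Q where "Q n = \<phi> (h [^]\<^bsub>G\<^esub> (n::nat)) w" for n
  note wV = axis_V[OF w]
  have V: "R n \<in> V" "Q n \<in> V" for n using act_V wV hc by (auto simp: R_def Q_def)
  have RA: "R n \<in> axis h" and QA: "Q n \<in> axis h" for n
    using image_inv_mem[OF _ _ pow_image[OF hc _ axis_image_self[OF hc]] w, of n]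
      pow_image_mem[OF hc _ axis_image_self[OF hc] w, of n] hc axis_V
    by (auto simp: R_def Q_def subset_iff)
  have RR: "d (R (Suc n)) (R n) = ?t" for n
  proof -
    have "d (R (Suc n)) (R n) = d w (\<phi> (h [^]\<^bsub>G\<^esub> Suc n) (R n))"
      unfolding R_def[of "Suc n"] by (rule dist_act_inv) (use hc wV V in auto)
    also have "\<phi> (h [^]\<^bsub>G\<^esub> Suc n) (R n) = \<phi> h w"
      unfolding act_pow_Suc[OF hc V(1)] using act_inv'[OF _ wV, of "h [^]\<^bsub>G\<^esub> n"] hc
      by (simp add: R_def)
    finally show ?thesis using axis_dist[OF w] by simp
  qed
  have QQ: "d (Q n) (Q (Suc n)) = ?t" for n
    using act_mult[OF wV, of "h [^]\<^bsub>G\<^esub> n" h] dist_act[of "h [^]\<^bsub>G\<^esub> n" w "\<phi> h w"] hc wV act_V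
      axis_dist[OF w] by (simp add: Q_def)
  have seg: "d (R n) a + d a (Q n) = 2 * n * ?t" "d (R n) (Q n) = 2 * n * ?t"
    if a: "a \<in> axis h" "d w a \<le> n" for a n
  proof -
    have "n \<le> n * ?t" using hyp_tl_pos[OF h] by simp
    then have "d w a \<le> n * ?t" using a by linarith
    from axis_between_pow[OF ni h w a(1) this]
    show "d (R n) a + d a (Q n) = 2 * n * ?t" "d (R n) (Q n) = 2 * n * ?t"
      by (simp_all add: R_def Q_def)
  qed
  have Rw: "d (R n) w = n * ?t" for n
    using dist_act_inv[of "h [^]\<^bsub>G\<^esub> n" w w] dist_axis_pow[OF ni h w, of n] hc wV
    by (simp add: R_def)
  \<comment> \<open>Approximates the Busemann function from the far point \<open>R n\<close>; the
    value no longer changes once \<open>n \<ge> d w a\<close>.\<close>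
  define x where "x n a = int (d (R n) a) - int (n * ?t)" for n a
  have x_Suc: "x (Suc n) a = x n a" if a: "a \<in> axis h" "d w a \<le> n" for a n
  proof -
    note aV = axis_V[OF a(1)]
    have "d (R (Suc n)) a \<le> ?t + d (R n) a"
      using dist_triangle[OF V(1) V(1) aV, of "Suc n" n] RR by simp
    moreover have "d a (Q (Suc n)) \<le> d a (Q n) + ?t"
      using dist_triangle[OF aV V(2) V(2), of "Suc n" n] QQ by simp
    moreover have "2 * Suc n * ?t = 2 * n * ?t + 2 * ?t" by (simp add: add_mult_distrib)
    moreover have "d w a \<le> Suc n" using a by simp
    ultimately have "d (R (Suc n)) a = ?t + d (R n) a"
      using seg(1)[OF a] seg(1)[OF a(1), of "Suc n"] by linarith
    then show ?thesis by (simp add: x_def)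
  qed
  have stable: "x m a = x n a" if "a \<in> axis h" "d w a \<le> n" "n \<le> m" for a n m
    using that(3)
  proof (induction rule: dec_induct)
    case (step m)
    then show ?case using x_Suc[of a m] that by simp
  qed simp
  define pos where "pos a = x (d w a) a" for a
  have pos_eq: "pos a = x n a" if "a \<in> axis h" "d w a \<le> n" for a n
    using stable[of a "d w a" n] that by (simp add: pos_def)
  have dist_x: "int (d a b) = \<bar>int (d (R n) a) - int (d (R n) b)\<bar>"
    if a: "a \<in> axis h" "d (R n) a + d a (Q n) = d (R n) (Q n)"
      and b: "b \<in> axis h" "d (R n) b + d b (Q n) = d (R n) (Q n)" for a b n
  proof -
    have ab: "a \<in> V" "b \<in> V" using a b axis_V by auto
    have "d (R n) (Q n) + d a b \<le> d (R n) a + d (Q n) b \<or> d (R n) (Q n) + d a b \<le> d (R n) b + d (Q n) a"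
      using four_point[OF V(1) V(2) ab] .
    moreover have "d (R n) a \<le> d (R n) b + d a b" "d (R n) b \<le> d (R n) a + d a b"
      using dist_triangle[OF V(1) ab(2,1)] dist_triangle[OF V(1) ab] dist_sym[OF ab] by auto
    moreover have "d (Q n) b = d b (Q n)" "d (Q n) a = d a (Q n)" using dist_sym V ab by auto
    ultimately show ?thesis using a b by linarith
  qed
  have dist_pos: "int (d a b) = \<bar>pos a - pos b\<bar>" if ab: "a \<in> axis h" "b \<in> axis h" for a b
  proof -
    define n where "n = max (d w a) (d w b)"
    have n: "d w a \<le> n" "d w b \<le> n" by (auto simp: n_def)
    have "int (d a b) = \<bar>int (d (R n) a) - int (d (R n) b)\<bar>"
      by (rule dist_x) (use ab n seg in simp_all)
    then show ?thesis using pos_eq ab n by (simp add: x_def)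
  qed
  have "inj_on pos (axis h)"
  proof (rule inj_onI)
    fix a b assume ab: "a \<in> axis h" "b \<in> axis h" "pos a = pos b"
    then have "d a b = 0" using dist_pos[of a b] by simp
    then show "a = b" using dist_eq_0 ab axis_V by auto
  qed
  moreover have "\<exists>a\<in>axis h. pos a = i" for i
  proof -
    \<comment> \<open>As \<open>tl h \<ge> 1\<close>, this \<open>n\<close> puts
      \<open>n * tl h + i\<close> between 0 and the length of the segment from \<open>R n\<close> to
      \<open>Q n\<close>, and it is large enough for the approximation to be exact at the point
      found.\<close>
    define n where "n = nat \<bar>i\<bar>"
    have ni: "int n = \<bar>i\<bar>" by (simp add: n_def)
    have "n \<le> n * ?t" using hyp_tl_pos[OF h] by simp
    then have nt: "int n \<le> int (n * ?t)" by linarith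
    have RQ: "d (R n) (Q n) = 2 * n * ?t" using seg(2)[OF w, of n] by simp
    have "2 * n * ?t = n * ?t + n * ?t" by (simp add: add_mult_distrib)
    then have "nat (int (n * ?t) + i) \<le> d (R n) (Q n)" using nt ni RQ by linarith
    from point_at_distance[OF V this]
    obtain a where a: "a \<in> V" "d (R n) a = nat (int (n * ?t) + i)"
      "d (R n) a + d a (Q n) = d (R n) (Q n)" .
    have aA: "a \<in> axis h" using tconvexD[OF tconvex_axis[OF hc] RA QA a(1,3)] .
    have "int (d w a) = \<bar>int (d (R n) w) - int (d (R n) a)\<bar>"
      by (rule dist_x[OF w _ aA a(3)]) (use seg[OF w, of n] in simp)
    moreover have "int (d (R n) a) = int (n * ?t) + i" using a(2) nt ni by linarith
    ultimately have "d w a \<le> n" and "x n a = i" using Rw[of n] ni by (simp_all add: x_def)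
    then have "pos a = i" using pos_eq[OF aA] by simp
    then show ?thesis using aA by blast
  qed
  ultimately have bij: "bij_betw pos (axis h) UNIV"
    unfolding bij_betw_def by (metis (mono_tags, lifting) UNIV_eq_I imageI)
  let ?f = "inv_into (axis h) pos"
  have f: "?f i \<in> axis h" "pos (?f i) = i" for i
    using bij inv_into_into[of i pos "axis h"] f_inv_into_f[of i pos "axis h"]
    by (auto simp: bij_betw_def)
  have "E (?f i) (?f j) \<longleftrightarrow> \<bar>i - j\<bar> = 1" for i j
    using dist_1_iff[OF axis_V[OF f(1)] axis_V[OF f(1)], of i j] dist_pos[OF f(1) f(1), of i j] f(2)
    by simp linarith
  then show ?thesis unfolding is_line_def using bij_betw_inv_into[OF bij] by blast
qed

text \<open>If every generator preserved the axis of \<open>h\<close>, so would \<open>G\<close>;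
  the axis lies in \<open>W\<close>, so by minimality it would be all of \<open>W\<close>, which is
  not a line.\<close>

lemma exists_conj_other_axis:
  assumes ni: "without_inversions G E \<phi>"
    and W: "minimal_subtree G V E \<phi> W" "\<not> is_line E W"
    and S: "S \<subseteq> carrier G" "generate G S = carrier G" and h: "hyp h"
  obtains t where "t \<in> S" "t \<otimes>\<^bsub>G\<^esub> h \<otimes>\<^bsub>G\<^esub> inv\<^bsub>G\<^esub> t \<noteq> h" "t \<otimes>\<^bsub>G\<^esub> h \<otimes>\<^bsub>G\<^esub> inv\<^bsub>G\<^esub> t \<noteq> inv\<^bsub>G\<^esub> h"
proof -
  have hc: "h \<in> carrier G" using hyp_carrier h .
  have W': "W \<subseteq> V" "W \<noteq> {}" "connected_in E W" "\<And>g. g \<in> carrier G \<Longrightarrow> \<phi> g ` W = W"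
    and min: "\<And>U. invariant_subtree G V E \<phi> U \<Longrightarrow> U \<subseteq> W \<Longrightarrow> U = W"
    using W by (auto simp: minimal_subtree_def invariant_subtree_def subtree_def)
  have sub: "axis h \<subseteq> W"
    using axis_subset_invariant[OF ni h connected_in_imp_tconvex[OF W'(1,3)] W'(2) W'(4)[OF hc]] .
  have "\<exists>t\<in>S. \<phi> t ` axis h \<noteq> axis h"
  proof (rule ccontr)
    assume "\<not> ?thesis"
    then have "\<phi> g ` axis h = axis h" if "g \<in> carrier G" for g
      using image_by_generators[OF S _ _ that, of "axis h"] axis_V by blast
    then have "invariant_subtree G V E \<phi> (axis h)"
      using tconvex_imp_connected_in[OF tconvex_axis[OF hc]] axis_V axis_nonempty
      by (auto simp: invariant_subtree_def subtree_def)
    then show False using min sub axis_is_line[OF ni h] W(2) by blast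
  qed
  then obtain t where "t \<in> S" "\<phi> t ` axis h \<noteq> axis h" by blast
  then show ?thesis using that conj_eq_imp_axis_image[OF hc] S by blast
qed

end

section \<open>Growth of balls\<close>

text \<open>Fekete's lemma: the limit is the infimum \<open>L\<close>. A good index \<open>M\<close>
  controls every large \<open>m\<close> through division with remainder, the remainders contributing
  the bounded term \<open>C\<close>. Convergence matters because \<open>lim\<close> says nothing
  about a divergent sequence.\<close>

lemma fekete_convergent:
  fixes b :: "nat \<Rightarrow> real"
  assumes sub: "\<And>m n. b (m + n) \<le> b m + b n" and nonneg: "\<And>m. b m \<ge> 0"
  shows "convergent (\<lambda>m. b m / real m)"
proof -
  define X where "X = (\<lambda>m. b m / real m) ` {1..}"
  define L where "L = Inf X"
  have bdd: "bdd_below X" and ne: "X \<noteq> {}"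
    using nonneg by (auto simp: X_def intro!: bdd_belowI[of _ 0])
  have L: "L \<le> b m / real m" if "m \<ge> 1" for m
    unfolding L_def by (rule cInf_lower) (use that bdd in \<open>auto simp: X_def\<close>)
  have mult: "b (q * M + r) \<le> real q * b M + b r" for q M r
  proof (induction q)
    case (Suc q)
    have "b (Suc q * M + r) \<le> b M + b (q * M + r)" using sub[of M "q * M + r"] by (simp add: add.assoc)
    then show ?case using Suc by (simp add: algebra_simps)
  qed simp
  have "(\<lambda>m. b m / real m) \<longlonglongrightarrow> L"
  proof (rule LIMSEQ_I)
    fix e :: real assume e: "e > 0"
    obtain y where y: "y \<in> X" "y < L + e / 2"
      using cInf_lessD[OF ne, of "L + e / 2"] e by (auto simp: L_def)
    then obtain M where M: "M \<ge> 1" "b M / real M < L + e / 2" by (auto simp: X_def)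
    define C where "C = Max (b ` {..<M})"
    have C: "b r \<le> C" if "r < M" for r unfolding C_def using that by (intro Max_ge) auto
    have C0: "C \<ge> 0" using C[of 0] nonneg[of 0] M by auto
    obtain N where N: "real N > 2 * C / e" using reals_Archimedean2 by blast
    show "\<exists>no. \<forall>m\<ge>no. norm (b m / real m - L) < e"
    proof (intro exI[of _ "max 1 N"] allI impI)
      fix m assume m: "m \<ge> max 1 N"
      have "b m \<le> real (m div M) * b M + b (m mod M)"
        using mult[of "m div M" M "m mod M"] by simp
      also have "\<dots> \<le> real (m div M) * b M + C" using C[of "m mod M"] M by simp
      also have "real (m div M) * b M = real (m div M * M) * (b M / real M)" using M by simp
      also have "\<dots> \<le> real m * (b M / real M)"
      proof (rule mult_right_mono)
        show "real (m div M * M) \<le> real m"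
          by (simp only: of_nat_le_iff div_times_less_eq_dividend)
      qed (use nonneg in simp)
      finally have "b m / real m \<le> b M / real M + C / real m" using m by (simp add: field_simps)
      moreover have "C / real m < e / 2"
      proof -
        have "2 * C / e < real m" using N m by linarith
        then show ?thesis using e m by (simp add: field_simps)
      qed
      moreover have "L \<le> b m / real m" using L m by simp
      ultimately have "\<bar>b m / real m - L\<bar> < e" using M(2) e by linarith
      then show "norm (b m / real m - L) < e" by simp
    qed
  qed
  then show ?thesis by (auto simp: convergent_def)
qed

section \<open>Word balls and their exponential growth\<close>

context group
begin

lemma foldr_mult_closed: "set ws \<subseteq> carrier G \<Longrightarrow> foldr (\<otimes>) ws \<one> \<in> carrier G"
  by (induction ws) auto

lemma foldr_mult_append:
  "set us \<subseteq> carrier G \<Longrightarrow> set vs \<subseteq> carrier G \<Longrightarrow>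
    foldr (\<otimes>) (us @ vs) \<one> = foldr (\<otimes>) us \<one> \<otimes> foldr (\<otimes>) vs \<one>"
proof (induction us)
  case (Cons u us)
  then show ?case using foldr_mult_closed[of us] foldr_mult_closed[of vs] by (simp add: m_assoc)
qed (simp add: foldr_mult_closed)

context
  fixes S assumes S: "S \<subseteq> carrier G" and gen: "generate G S = carrier G"
begin

private abbreviation "L \<equiv> S \<union> (\<lambda>s. inv s) ` S"

lemma letters_closed: "set ws \<subseteq> L \<Longrightarrow> set ws \<subseteq> carrier G"
  using S by auto

lemma word_exists: "g \<in> carrier G \<Longrightarrow> \<exists>ws. set ws \<subseteq> L \<and> foldr (\<otimes>) ws \<one> = g"
  unfolding gen[symmetric]
proof (induction rule: generate.induct)
  case one
  then show ?case by (intro exI[of _ "[]"]) auto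
next
  case (incl h)
  then show ?case using S by (intro exI[of _ "[h]"]) auto
next
  case (inv h)
  then show ?case using S by (intro exI[of _ "[inv h]"]) auto
next
  case (eng h1 h2)
  then obtain us vs where "set us \<subseteq> L" "foldr (\<otimes>) us \<one> = h1" "set vs \<subseteq> L" "foldr (\<otimes>) vs \<one> = h2"
    by blast
  then show ?case using foldr_mult_append[of us vs] letters_closed[of us] letters_closed[of vs]
    by (intro exI[of _ "us @ vs"]) auto
qed

text \<open>Replaces the \<open>LEAST\<close> in \<open>word_length\<close> by the existence of a
  short word. Since \<open>S\<close> generates, the set of word lengths is never empty, so the
  \<open>LEAST\<close> is attained.\<close>

lemma mem_word_ball:
  "g \<in> word_ball G S m \<longleftrightarrow> (\<exists>ws. set ws \<subseteq> L \<and> length ws \<le> m \<and> foldr (\<otimes>) ws \<one> = g)"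
proof
  assume g: "g \<in> word_ball G S m"
  then have gc: "g \<in> carrier G" and le: "word_length G S g \<le> m"
    by (auto simp: word_ball_def word_dist_def)
  have "\<exists>l ws. set ws \<subseteq> L \<and> length ws = l \<and> foldr (\<otimes>) ws \<one> = g"
    using word_exists[OF gc] by blast
  from LeastI_ex[OF this] le
  show "\<exists>ws. set ws \<subseteq> L \<and> length ws \<le> m \<and> foldr (\<otimes>) ws \<one> = g"
    unfolding word_length_def by metis
next
  assume "\<exists>ws. set ws \<subseteq> L \<and> length ws \<le> m \<and> foldr (\<otimes>) ws \<one> = g"
  then obtain ws where ws: "set ws \<subseteq> L" "length ws \<le> m" "foldr (\<otimes>) ws \<one> = g" by blast
  have "word_length G S g \<le> length ws" unfolding word_length_def by (rule Least_le) (use ws in blast)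
  moreover have "g \<in> carrier G" using foldr_mult_closed[OF letters_closed[OF ws(1)]] ws by simp
  ultimately show "g \<in> word_ball G S m" using ws by (auto simp: word_ball_def word_dist_def)
qed

lemma word_ball_closed: "word_ball G S m \<subseteq> carrier G"
  by (auto simp: word_ball_def)

lemma word_ball_mono: "m \<le> n \<Longrightarrow> word_ball G S m \<subseteq> word_ball G S n"
  by (auto simp: word_ball_def)

lemma one_word_ball: "\<one> \<in> word_ball G S m"
  unfolding mem_word_ball by (intro exI[of _ "[]"]) auto

lemma generator_word_ball: "s \<in> S \<Longrightarrow> s \<in> word_ball G S 1"
  unfolding mem_word_ball using S by (intro exI[of _ "[s]"]) auto

lemma mult_word_ball:
  assumes "g \<in> word_ball G S m" "h \<in> word_ball G S n" shows "g \<otimes> h \<in> word_ball G S (m + n)"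
proof -
  obtain us vs where w: "set us \<subseteq> L" "length us \<le> m" "foldr (\<otimes>) us \<one> = g"
    "set vs \<subseteq> L" "length vs \<le> n" "foldr (\<otimes>) vs \<one> = h" using assms unfolding mem_word_ball by blast
  then show ?thesis unfolding mem_word_ball
    using foldr_mult_append[of us vs] letters_closed[of us] letters_closed[of vs]
    by (intro exI[of _ "us @ vs"]) auto
qed

lemma inv_word_ball:
  assumes "g \<in> word_ball G S m" shows "inv g \<in> word_ball G S m"
proof -
  have "inv (foldr (\<otimes>) ws \<one>) \<in> word_ball G S (length ws)" if "set ws \<subseteq> L" for ws
    using that
  proof (induction ws)
    case Nil
    then show ?case by (simp add: one_word_ball)
  next
    case (Cons w ws)
    have w: "w \<in> carrier G" "inv w \<in> L" using Cons.prems S by auto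
    have "inv w \<in> word_ball G S 1" unfolding mem_word_ball using w by (intro exI[of _ "[inv w]"]) auto
    then have "inv (foldr (\<otimes>) ws \<one>) \<otimes> inv w \<in> word_ball G S (length ws + 1)"
      using Cons by (intro mult_word_ball) auto
    then show ?case using inv_mult_group[OF w(1) foldr_mult_closed[of ws]] letters_closed[of ws] Cons.prems
      by simp
  qed
  moreover obtain ws where "set ws \<subseteq> L" "length ws \<le> m" "foldr (\<otimes>) ws \<one> = g"
    using assms unfolding mem_word_ball by blast
  ultimately show ?thesis using word_ball_mono by blast
qed

lemma pow_word_ball: "g \<in> word_ball G S m \<Longrightarrow> g [^] n \<in> word_ball G S (n * m)"
proof (induction n)
  case (Suc n)
  then show ?case using mult_word_ball[of "g [^] n" "n * m" g m] by (simp add: add.commute)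
qed (simp add: one_word_ball)

lemma conj_word_ball:
  "g \<in> word_ball G S m \<Longrightarrow> h \<in> word_ball G S l \<Longrightarrow> h \<otimes> g \<otimes> inv h \<in> word_ball G S (2 * l + m)"
  using mult_word_ball[OF mult_word_ball inv_word_ball, of h l g m h l]
  by (simp add: mult_2 add.commute add.left_commute)

lemma finite_word_ball: assumes "finite S" shows "finite (word_ball G S m)"
proof -
  have "word_ball G S m \<subseteq> (\<lambda>ws. foldr (\<otimes>) ws \<one>) ` {ws. set ws \<subseteq> L \<and> length ws \<le> m}"
    unfolding subset_iff mem_word_ball by blast
  moreover have "finite {ws. set ws \<subseteq> L \<and> length ws \<le> m}"
    using assms by (intro finite_lists_length_le) auto
  ultimately show ?thesis by (meson finite_imageI finite_subset)
qed

lemma word_ball_add_subset: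
  "word_ball G S (m + n) \<subseteq> (\<lambda>(g, h). g \<otimes> h) ` (word_ball G S m \<times> word_ball G S n)"
proof
  fix g assume "g \<in> word_ball G S (m + n)"
  then obtain ws where ws: "set ws \<subseteq> L" "length ws \<le> m + n" "foldr (\<otimes>) ws \<one> = g"
    unfolding mem_word_ball by blast
  have sub: "set (take m ws) \<subseteq> L" "set (drop m ws) \<subseteq> L"
    using ws(1) by (meson set_take_subset set_drop_subset subset_trans)+
  have "g = foldr (\<otimes>) (take m ws) \<one> \<otimes> foldr (\<otimes>) (drop m ws) \<one>"
    using foldr_mult_append[OF letters_closed[OF sub(1)] letters_closed[OF sub(2)]] ws by simp
  moreover have "foldr (\<otimes>) (take m ws) \<one> \<in> word_ball G S m" "foldr (\<otimes>) (drop m ws) \<one> \<in> word_ball G S n"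
    unfolding mem_word_ball
    by (rule exI[of _ "take m ws"], use sub ws in simp, rule exI[of _ "drop m ws"], use sub ws in simp)
  ultimately show "g \<in> (\<lambda>(g, h). g \<otimes> h) ` (word_ball G S m \<times> word_ball G S n)" by blast
qed

lemma entropy_LIMSEQ:
  assumes "finite S"
  shows "(\<lambda>m. ln (real (card (word_ball G S m))) / real m) \<longlonglongrightarrow> entropy G S"
  unfolding entropy_def
proof (rule convergent_LIMSEQ_iff[THEN iffD1], rule fekete_convergent)
  let ?B = "word_ball G S"
  note fin = finite_word_ball[OF assms]
  have pos: "card (?B m) \<ge> 1" for m
    using one_word_ball fin[of m] by (metis One_nat_def Suc_leI card_gt_0_iff empty_iff)
  fix m n
  show "ln (real (card (?B m))) \<ge> 0" using pos[of m] by simp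
  have "card (?B (m + n)) \<le> card ((\<lambda>(g, h). g \<otimes> h) ` (?B m \<times> ?B n))"
    by (rule card_mono) (use fin word_ball_add_subset in auto)
  also have "\<dots> \<le> card (?B m \<times> ?B n)" by (rule card_image_le) (use fin in auto)
  finally have "real (card (?B (m + n))) \<le> real (card (?B m)) * real (card (?B n))"
    by (simp add: card_cartesian_product flip: of_nat_mult)
  then have "ln (real (card (?B (m + n)))) \<le> ln (real (card (?B m)) * real (card (?B n)))"
    using pos[of "m + n"] by (subst ln_le_cancel_iff) auto
  also have "\<dots> = ln (real (card (?B m))) + ln (real (card (?B n)))"
    using pos[of m] pos[of n] by (intro ln_mult_pos) auto
  finally show "ln (real (card (?B (m + n)))) \<le> \<dots>" .
qed

lemma entropy_nonneg: assumes "finite S" shows "entropy G S \<ge> 0"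
proof (rule LIMSEQ_le_const[OF entropy_LIMSEQ[OF assms]])
  have "card (word_ball G S m) \<ge> 1" for m
    using one_word_ball finite_word_ball[OF assms, of m]
    by (metis One_nat_def Suc_leI card_gt_0_iff empty_iff)
  then show "\<exists>N. \<forall>n\<ge>N. 0 \<le> ln (real (card (word_ball G S n))) / real n" by auto
qed

text \<open>Growth is needed only along the radii \<open>Suc r * l\<close>, because the limit
  exists. The exponent \<open>r\<close> instead of \<open>Suc r\<close> costs the factor
  \<open>r / Suc r\<close>, which tends to 1.\<close>

lemma entropy_ge_of_growth:
  assumes "finite S" and l: "l > 0" and c: "c \<ge> 1"
    and growth: "\<And>r. c ^ r \<le> card (word_ball G S (Suc r * l))"
  shows "entropy G S \<ge> ln (real c) / real l"
proof (rule LIMSEQ_le)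
  let ?X = "\<lambda>m. ln (real (card (word_ball G S m))) / real m"
  have "strict_mono (\<lambda>r. Suc r * l)" using l by (auto intro: strict_monoI)
  from LIMSEQ_subseq_LIMSEQ[OF entropy_LIMSEQ[OF assms(1)] this]
  show "(\<lambda>r. ?X (Suc r * l)) \<longlonglongrightarrow> entropy G S" by (simp only: o_def)
  have "(\<lambda>r. real r / real (Suc r) * (ln (real c) / real l)) \<longlonglongrightarrow> 1 * (ln (real c) / real l)"
    by (intro tendsto_intros LIMSEQ_n_over_Suc_n)
  then show "(\<lambda>r. real r / real (Suc r) * (ln (real c) / real l)) \<longlonglongrightarrow> ln (real c) / real l" by simp
  show "\<exists>N. \<forall>r\<ge>N. real r / real (Suc r) * (ln (real c) / real l) \<le> ?X (Suc r * l)"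
  proof (intro exI allI impI)
    fix r :: nat
    have "real r * ln (real c) = ln (real (c ^ r))" using c by (simp add: ln_realpow)
    also have "\<dots> \<le> ln (real (card (word_ball G S (Suc r * l))))"
    proof (subst ln_le_cancel_iff)
      have "c ^ r \<ge> 1" using c by simp
      then show "0 < real (c ^ r)" "0 < real (card (word_ball G S (Suc r * l)))"
        using growth[of r] by linarith+
    qed (use growth in simp)
    finally have "real r * ln (real c) / real (Suc r * l) \<le> ?X (Suc r * l)"
      by (intro divide_right_mono) auto
    then show "real r / real (Suc r) * (ln (real c) / real l) \<le> ?X (Suc r * l)"
      by (simp only: times_divide_times_eq of_nat_mult)
  qed
qed

end
end

section \<open>Chains and antichains\<close>

text \<open>Mirsky's argument: \<open>h x\<close> is the size of a largest chain with greatest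
  element \<open>x\<close>. It increases strictly along \<open>r\<close>, so its level sets are
  antichains. There are \<open>H\<close> possible levels, \<open>H\<close> is the size of some
  chain, and the largest level has \<open>M\<close> elements, so \<open>card X \<le> H * M\<close>;
  the larger factor wins.\<close>

lemma chain_or_antichain:
  fixes r :: "'b \<Rightarrow> 'b \<Rightarrow> bool"
  assumes fin: "finite X" and irr: "\<And>x. x \<in> X \<Longrightarrow> \<not> r x x"
    and tr: "\<And>x y z. x \<in> X \<Longrightarrow> y \<in> X \<Longrightarrow> z \<in> X \<Longrightarrow> r x y \<Longrightarrow> r y z \<Longrightarrow> r x z"
  obtains Y where "Y \<subseteq> X" "card X \<le> card Y * card Y"
    "(\<forall>x\<in>Y. \<forall>y\<in>Y. x \<noteq> y \<longrightarrow> r x y \<or> r y x) \<or> (\<forall>x\<in>Y. \<forall>y\<in>Y. \<not> r x y)"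
proof (cases "X = {}")
  case True
  then show ?thesis using that[of "{}"] by simp
next
  case False
  define Ch where "Ch C x \<longleftrightarrow> C \<subseteq> X \<and> x \<in> C \<and> (\<forall>c\<in>C. c \<noteq> x \<longrightarrow> r c x) \<and>
      (\<forall>a\<in>C. \<forall>b\<in>C. a \<noteq> b \<longrightarrow> r a b \<or> r b a)" for C x
  define h where "h x = Max (card ` {C. Ch C x})" for x
  have finC: "finite {C. Ch C x}" for x
    by (rule finite_subset[of _ "Pow X"]) (use fin in \<open>auto simp: Ch_def\<close>)
  have ex: "\<exists>C. Ch C x \<and> card C = h x" if "x \<in> X" for x
  proof -
    have "Ch {x} x" using that by (auto simp: Ch_def)
    then have "h x \<in> card ` {C. Ch C x}" unfolding h_def using finC by (intro Max_in) auto
    then show ?thesis by auto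
  qed
  have le: "card C \<le> h x" if "Ch C x" for C x
    unfolding h_def using that finC by (intro Max_ge) auto
  have less: "h x < h y" if xy: "x \<in> X" "y \<in> X" "r x y" for x y
  proof -
    obtain C where C: "Ch C x" "card C = h x" using ex xy by blast
    have ry: "r c y" if "c \<in> C" for c
    proof (cases "c = x")
      case False
      then have "c \<in> X" "r c x" using C(1) that unfolding Ch_def by blast+
      then show ?thesis using tr[of c x y] xy by blast
    qed (use xy in simp)
    then have "y \<notin> C" using irr xy by blast
    moreover have "finite C" using C(1) fin finite_subset unfolding Ch_def by blast
    moreover have "Ch (insert y C) y" using C(1) ry xy unfolding Ch_def by blast
    ultimately show ?thesis using le[of "insert y C" y] C(2) by simp
  qed
  define H where "H = Max (h ` X)"
  have hH: "h x \<le> H" if "x \<in> X" for x unfolding H_def using that fin by (intro Max_ge) auto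
  have h1: "1 \<le> h x" if "x \<in> X" for x using le[of "{x}" x] that by (auto simp: Ch_def)
  obtain x0 where x0: "x0 \<in> X" "h x0 = H"
    using Max_in[of "h ` X"] fin False unfolding H_def by fastforce
  obtain C where C: "Ch C x0" "card C = H" using ex x0 by metis
  define lev where "lev i = {x \<in> X. h x = i}" for i
  define M where "M = Max ((\<lambda>i. card (lev i)) ` {1..H})"
  have H1: "1 \<le> H" using h1 x0 by auto
  obtain i0 where i0: "card (lev i0) = M"
    using Max_in[of "(\<lambda>i. card (lev i)) ` {1..H}"] H1 unfolding M_def by fastforce
  have "X = (\<Union>i\<in>{1..H}. lev i)" using hH h1 by (auto simp: lev_def)
  then have "card X \<le> (\<Sum>i\<in>{1..H}. card (lev i))"
    using card_UN_le[of "{1..H}" lev] by simp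
  also have "\<dots> \<le> (\<Sum>i\<in>{1..H}. M)"
    by (rule sum_mono) (auto simp: M_def intro!: Max_ge)
  also have "\<dots> = H * M" by simp
  finally have card: "card X \<le> H * M" .
  show ?thesis
  proof (cases "M \<le> H")
    case True
    then have "card X \<le> card C * card C"
      using order_trans[OF card mult_le_mono2[OF True]] C(2) by simp
    then show ?thesis using that[of C] C(1) unfolding Ch_def by blast
  next
    case False
    then have "card X \<le> card (lev i0) * card (lev i0)"
      using order_trans[OF card mult_le_mono1[of H M M]] i0 by simp
    moreover have "\<forall>x\<in>lev i0. \<forall>y\<in>lev i0. \<not> r x y" using less by (fastforce simp: lev_def)
    ultimately show ?thesis using that[of "lev i0"] unfolding lev_def by blast
  qed
qed

section \<open>Ping-pong\<close>

text \<open>Values of the words with \<open>r + 1\<close> letters that begin with \<open>i\<close>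
  and have no two equal neighbours. Fixing the first letter leaves \<open>card Y - 1\<close> choices
  at each of the \<open>r\<close> remaining places.\<close>

primrec pp_words ::
  "('g, 'm) monoid_scheme \<Rightarrow> ('i \<Rightarrow> 'g) \<Rightarrow> 'i set \<Rightarrow> nat \<Rightarrow> 'i \<Rightarrow> 'g set" where
  "pp_words G f Y 0 i = {f i}"
| "pp_words G f Y (Suc r) i = (\<lambda>g. f i \<otimes>\<^bsub>G\<^esub> g) ` (\<Union>j\<in>Y - {i}. pp_words G f Y r j)"

context tree_action
begin

text \<open>A value with first letter \<open>j\<close> sends \<open>x0\<close> into
  \<open>U j\<close>, so values with different first letters differ, and left multiplication is
  injective. Keeping the position of \<open>x0\<close> in the induction thus yields the exact
  count.\<close>

lemma pp_words_props:
  assumes Y: "finite Y" and f: "\<And>i. i \<in> Y \<Longrightarrow> f i \<in> carrier G"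
    and U: "\<And>i. i \<in> Y \<Longrightarrow> U i \<subseteq> V" "\<And>i j. i \<in> Y \<Longrightarrow> j \<in> Y \<Longrightarrow> i \<noteq> j \<Longrightarrow> U i \<inter> U j = {}"
    and pp: "\<And>i x. i \<in> Y \<Longrightarrow> x \<in> V \<Longrightarrow> x \<notin> U i \<Longrightarrow> \<phi> (f i) x \<in> U i"
    and x0: "x0 \<in> V" "\<And>i. i \<in> Y \<Longrightarrow> x0 \<notin> U i"
    and i: "i \<in> Y"
  shows "finite (pp_words G f Y r i) \<and> card (pp_words G f Y r i) = (card Y - 1) ^ r \<and>
    (\<forall>g\<in>pp_words G f Y r i. g \<in> carrier G \<and> \<phi> g x0 \<in> U i)"
  using i
proof (induction r arbitrary: i)
  case 0
  then show ?case using f pp x0 by auto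
next
  case (Suc r)
  let ?W = "pp_words G f Y r"
  have IH: "finite (?W j)" "card (?W j) = (card Y - 1) ^ r"
    "\<And>g. g \<in> ?W j \<Longrightarrow> g \<in> carrier G \<and> \<phi> g x0 \<in> U j" if "j \<in> Y" for j using Suc.IH[OF that] by auto
  have disj: "?W j \<inter> ?W l = {}" if "j \<in> Y" "l \<in> Y" "j \<noteq> l" for j l
    using IH(3)[OF that(1)] IH(3)[OF that(2)] U(2)[OF that] by fastforce
  have card: "card (\<Union>j\<in>Y - {i}. ?W j) = (\<Sum>j\<in>Y - {i}. card (?W j))"
    by (rule card_UN_disjoint) (use Y IH disj in auto)
  have "inj_on (\<lambda>g. f i \<otimes>\<^bsub>G\<^esub> g) (\<Union>j\<in>Y - {i}. ?W j)"
    by (rule inj_onI) (use f Suc.prems IH(3) in \<open>auto simp: grp.inj_on_cmult\<close>)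
  then have "card (pp_words G f Y (Suc r) i) = (\<Sum>j\<in>Y - {i}. card (?W j))"
    by (simp add: card_image card)
  also have "\<dots> = (card Y - 1) ^ Suc r" using IH(2) Suc.prems Y by simp
  finally have 1: "card (pp_words G f Y (Suc r) i) = (card Y - 1) ^ Suc r" .
  have 2: "g \<in> carrier G \<and> \<phi> g x0 \<in> U i" if g: "g \<in> pp_words G f Y (Suc r) i" for g
  proof -
    obtain j u where j: "j \<in> Y" "j \<noteq> i" "u \<in> ?W j" "g = f i \<otimes>\<^bsub>G\<^esub> u" using g by auto
    have u: "u \<in> carrier G" "\<phi> u x0 \<in> U j" using IH(3)[OF j(1,3)] by auto
    have "\<phi> u x0 \<in> V" "\<phi> u x0 \<notin> U i" using u U(1)[OF j(1)] U(2)[OF j(1) Suc.prems j(2)] by auto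
    then show ?thesis using pp[OF Suc.prems] act_mult[OF x0(1) f[OF Suc.prems] u(1)] f[OF Suc.prems] u j
      by simp
  qed
  have "finite (pp_words G f Y (Suc r) i)" using Y IH(1) by simp
  then show ?case using 1 2 by blast
qed

lemma pp_words_ball:
  assumes S: "S \<subseteq> carrier G" "generate G S = carrier G"
    and f: "\<And>i. i \<in> Y \<Longrightarrow> f i \<in> word_ball G S l" and i: "i \<in> Y"
  shows "pp_words G f Y r i \<subseteq> word_ball G S (Suc r * l)"
  using i
proof (induction r arbitrary: i)
  case 0
  then show ?case using f by simp
next
  case (Suc r)
  show ?case
  proof
    fix g assume "g \<in> pp_words G f Y (Suc r) i"
    then obtain j u where j: "j \<in> Y" "u \<in> pp_words G f Y r j" "g = f i \<otimes>\<^bsub>G\<^esub> u" by auto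
    then show "g \<in> word_ball G S (Suc (Suc r) * l)"
      using grp.mult_word_ball[OF S f[OF Suc.prems], of u "Suc r * l"] Suc.IH[OF j(1)] by auto
  qed
qed

lemma ping_pong_entropy:
  assumes S: "finite S" "S \<subseteq> carrier G" "generate G S = carrier G"
    and Y: "finite Y" "card Y \<ge> 2" and l: "l > 0"
    and f: "\<And>i. i \<in> Y \<Longrightarrow> f i \<in> word_ball G S l"
    and U: "\<And>i. i \<in> Y \<Longrightarrow> U i \<subseteq> V" "\<And>i j. i \<in> Y \<Longrightarrow> j \<in> Y \<Longrightarrow> i \<noteq> j \<Longrightarrow> U i \<inter> U j = {}"
    and pp: "\<And>i x. i \<in> Y \<Longrightarrow> x \<in> V \<Longrightarrow> x \<notin> U i \<Longrightarrow> \<phi> (f i) x \<in> U i"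
    and x0: "x0 \<in> V" "\<And>i. i \<in> Y \<Longrightarrow> x0 \<notin> U i"
  shows "entropy G S \<ge> ln (real (card Y - 1)) / real l"
proof (rule grp.entropy_ge_of_growth[OF S(2,3,1) l])
  fix r
  obtain i where i: "i \<in> Y" using Y by fastforce
  have fc: "f i \<in> carrier G" if "i \<in> Y" for i
    using f[OF that] grp.word_ball_closed[OF S(2,3)] by blast
  have "(card Y - 1) ^ r = card (pp_words G f Y r i)"
    using pp_words_props[OF Y(1) fc U pp x0 i] by simp
  also have "\<dots> \<le> card (word_ball G S (Suc r * l))"
    by (rule card_mono[OF grp.finite_word_ball[OF S(2,3,1)] pp_words_ball[OF S(2,3) f i]])
  finally show "(card Y - 1) ^ r \<le> card (word_ball G S (Suc r * l))" .
qed (use Y in simp)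

end

section \<open>Families of conjugate hyperbolic elements\<close>

context tree_action
begin

text \<open>If the two projections differ, the segment from \<open>u\<close> to \<open>v\<close>
  runs through both by \<open>proj_bridge\<close>, so they lie on both axes. Their distance is then
  bounded by \<open>overlap_eq_or_inv\<close>.\<close>

lemma proj_axis_small:
  assumes ni: "without_inversions G E \<phi>" and acyl: "acylindrical G V E \<phi> k"
    and ab: "hyp a" "hyp b" and t: "tl a = tl b" and ne: "a \<noteq> b" "a \<noteq> inv\<^bsub>G\<^esub> b"
    and uv: "u \<in> axis b" "v \<in> axis b"
  shows "d (proj (axis a) u) (proj (axis a) v) \<le> tl a + k"
proof (rule ccontr)
  let ?p = "proj (axis a) u" and ?q = "proj (axis a) v"
  assume far: "\<not> d ?p ?q \<le> tl a + k"
  have A: "tconvex (axis a)" "axis a \<noteq> {}" and B: "tconvex (axis b)"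
    using tconvex_axis hyp_carrier ab axis_nonempty by auto
  have V: "u \<in> V" "v \<in> V" "?p \<in> V" "?q \<in> V" using uv axis_V proj_V[OF A] by auto
  have "?p \<noteq> ?q" using far by auto
  from proj_bridge[OF A V(1,2) this] have eq: "d u v = d u ?p + d ?p ?q + d ?q v" .
  have "d u ?p + d ?p v = d u v"
    using dist_triangle[OF V(3,4,2)] dist_triangle[OF V(1,3,2)] eq by linarith
  then have p: "?p \<in> axis b" using tconvexD[OF B uv V(3)] by blast
  have "d u ?q + d ?q v = d u v"
    using dist_triangle[OF V(1,3,4)] dist_triangle[OF V(1,4,2)] eq by linarith
  then have q: "?q \<in> axis b" using tconvexD[OF B uv V(4)] by blast
  have "a = b \<or> a = inv\<^bsub>G\<^esub> b"
    by (rule overlap_eq_or_inv[OF ni acyl ab t, of ?p ?q]) (use p q far proj_in[OF A(2)] in auto)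
  then show False using ne by blast
qed

text \<open>Let T = \<open>P * tl g\<close>. The powers move \<open>p\<close> and \<open>e\<close>
  far from themselves, so only crossings matter. If both powers move the same point near the other
  one, its two images are too close to each other, since they are T apart. If one moves
  \<open>p\<close> near \<open>e\<close> and the other \<open>e\<close> near \<open>p\<close>, their
  composite moves a point by at most \<open>4 * R\<close>, although it is the power
  \<open>3 * P\<close>.\<close>

lemma power_avoiding:
  assumes ni: "without_inversions G E \<phi>" and g: "hyp g" and pe: "p \<in> axis g" "e \<in> axis g"
    and P: "4 * R < P * tl g"
  shows "\<exists>N\<in>{P, 2 * P}. \<forall>a\<in>{p, e}. \<forall>b\<in>{p, e}. 2 * R < d (\<phi> (g [^]\<^bsub>G\<^esub> N) a) b"
proof -
  have gc: "g \<in> carrier G" using hyp_carrier g .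
  let ?x = "\<phi> (g [^]\<^bsub>G\<^esub> P)" and ?y = "\<phi> (g [^]\<^bsub>G\<^esub> (2 * P))"
  have V: "p \<in> V" "e \<in> V" using pe axis_V by auto
  have xV: "?x a \<in> V" "?y a \<in> V" if "a \<in> V" for a using act_V that gc by auto
  have yx: "?y a = ?x (?x a)" if "a \<in> V" for a
    using act_mult[OF that, of "g [^]\<^bsub>G\<^esub> P" "g [^]\<^bsub>G\<^esub> P"] gc by (simp add: grp.nat_pow_mult mult_2)
  have x3: "?x (?y a) = \<phi> (g [^]\<^bsub>G\<^esub> (3 * P)) a" "?y (?x a) = \<phi> (g [^]\<^bsub>G\<^esub> (3 * P)) a" if "a \<in> V" for a
    using act_mult[OF that, of "g [^]\<^bsub>G\<^esub> P" "g [^]\<^bsub>G\<^esub> (2 * P)"]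
      act_mult[OF that, of "g [^]\<^bsub>G\<^esub> (2 * P)" "g [^]\<^bsub>G\<^esub> P"] gc by (simp_all add: grp.nat_pow_mult)
  let ?T = "P * tl g"
  have D: "d a (?x a) = ?T" "d a (?y a) = 2 * ?T" "d a (\<phi> (g [^]\<^bsub>G\<^esub> (3 * P)) a) = 3 * ?T"
    if "a \<in> axis g" for a using dist_axis_pow[OF ni g that] by auto
  have self: "2 * R < d (?x a) a" "2 * R < d (?y a) a" if "a \<in> {p, e}" for a
    using D[of a] that pe P dist_sym[of a "?x a"] dist_sym[of a "?y a"] V xV by auto
  show ?thesis
  proof (cases "2 * R < d (?x p) e \<and> 2 * R < d (?x e) p")
    case True
    then show ?thesis using self by (intro bexI[of _ P]) auto
  next
    case 1: False
    have "2 * R < d (?y p) e \<and> 2 * R < d (?y e) p"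
    proof (rule ccontr)
      assume 2: "\<not> ?thesis"
      have step: "?T \<le> d (?x a) b + d (?y a) b" if "a \<in> axis g" "b \<in> V" for a b
      proof -
        have aV: "a \<in> V" using that axis_V by auto
        have "d (?x a) (?y a) = ?T"
          unfolding yx[OF aV] using dist_act[OF _ aV xV(1)[OF aV], of "g [^]\<^bsub>G\<^esub> P"] gc D[OF that(1)] by simp
        then show ?thesis
          using dist_triangle[OF xV(1)[OF aV] that(2) xV(2)[OF aV]] dist_sym[OF that(2) xV(2)[OF aV]]
          by linarith
      qed
      have cross: "3 * ?T \<le> d (?x b) a + d (?y a) b" if "a \<in> axis g" "b \<in> V" for a b
      proof -
        have aV: "a \<in> V" using that axis_V by auto
        have "d (?x (?y a)) (?x b) = d (?y a) b" using dist_act gc xV[OF aV] that by auto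
        moreover have "d a (?x (?y a)) = 3 * ?T" using D[OF that(1)] x3[OF aV] by simp
        ultimately show ?thesis
          using dist_triangle[OF aV xV(1)[OF that(2)] xV(1)[OF xV(2)[OF aV]]]
            dist_sym[OF aV xV(1)[OF that(2)]] dist_sym[OF xV(1)[OF that(2)] xV(1)[OF xV(2)[OF aV]]]
          by linarith
      qed
      show False
        using 1 2 P step[OF pe(1) V(2)] step[OF pe(2) V(1)] cross[OF pe(1) V(2)] cross[OF pe(2) V(1)]
        by linarith
    qed
    then show ?thesis using self by (intro bexI[of _ "2 * P"]) auto
  qed
qed

text \<open>Here \<open>m\<close> is the size of the chain or antichain. The sets \<open>U i\<close>
  consist of the vertices whose projection to the axis of \<open>i\<close> avoids the two places;
  the Behrstock alternative makes them disjoint, and \<open>power_avoiding\<close> supplies the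
  letters.\<close>

lemma entropy_of_conjugate_family:
  assumes ni: "without_inversions G E \<phi>" and acyl: "acylindrical G V E \<phi> k"
    and S: "finite S" "S \<subseteq> carrier G" "generate G S = carrier G"
    and X: "finite X" "\<And>g. g \<in> X \<Longrightarrow> hyp g" "\<And>g. g \<in> X \<Longrightarrow> tl g = t"
      "\<And>a b. a \<in> X \<Longrightarrow> b \<in> X \<Longrightarrow> a \<noteq> b \<Longrightarrow> a \<noteq> inv\<^bsub>G\<^esub> b"
    and P: "8 * (t + k) < P * t" and l: "l > 0"
    and ball: "\<And>g N. g \<in> X \<Longrightarrow> N \<in> {P, 2 * P} \<Longrightarrow> g [^]\<^bsub>G\<^esub> N \<in> word_ball G S l"
  obtains m where "card X \<le> m * m" "m \<ge> 2 \<Longrightarrow> entropy G S \<ge> ln (real (m - 1)) / real l"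
proof -
  obtain x0 where x0: "x0 \<in> V" using vertices_nonempty by blast
  let ?D = "t + k"
  define pr where "pr i = proj (axis i)" for i
  have Xc: "i \<in> carrier G" if "i \<in> X" for i using hyp_carrier X(2) that by auto
  have A: "tconvex (axis i)" "axis i \<noteq> {}" if "i \<in> X" for i using tconvex_axis Xc axis_nonempty that by auto
  have prA: "pr i y \<in> axis i" for i y unfolding pr_def by (rule proj_in[OF axis_nonempty])
  have prV: "pr i y \<in> V" for i y using prA axis_V by blast
  have beh: "pr j y \<in> pr j ` axis i" if "i \<in> X" "j \<in> X" "y \<in> V" "pr i y \<notin> pr i ` axis j" for i j y
    using behrstock[OF A[OF that(1)] A[OF that(2)] that(3)] that(4) unfolding pr_def by blast
  have small: "d (pr i u) (pr i v) \<le> ?D" if "i \<in> X" "j \<in> X" "i \<noteq> j" "u \<in> axis j" "v \<in> axis j" for i j u v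
    using proj_axis_small[OF ni acyl X(2)[OF that(1)] X(2)[OF that(2)] _ that(3) X(4)[OF that(1-3)] that(4,5)]
      X(3) that unfolding pr_def by simp
  \<comment> \<open>Far means beyond \<open>?D\<close>, the bound on the diameter of the projection
    of one axis to another. As every point of the axis of \<open>j\<close> is included,
    \<open>pr i x0\<close> is not a projection of such a point, as \<open>beh\<close>
    requires.\<close>
  define r where "r i j \<longleftrightarrow> (\<forall>u\<in>axis j. ?D < d (pr i u) (pr i x0))" for i j
  have irr: "\<not> r i i" if "i \<in> X" for i
    using proj_id[OF A(1)[OF that] prA[of i x0]] prA[of i x0] unfolding r_def pr_def by fastforce
  have base: "pr j x0 \<in> pr j ` axis i" if "i \<in> X" "j \<in> X" "r i j" for i j
    by (rule beh[OF that(1,2) x0]) (use that(3) in \<open>fastforce simp: r_def\<close>)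
  \<comment> \<open>Seen from the axis of \<open>j\<close>, the axis of \<open>i\<close> projects
    within \<open>?D\<close> of the projection of \<open>x0\<close>, but the axis of
    \<open>l\<close> projects beyond that; so \<open>beh\<close> transfers back to the axis of
    \<open>i\<close>.\<close>
  have nested: "pr i z \<in> pr i ` axis j"
    if ijl: "i \<in> X" "j \<in> X" "l \<in> X" "r i j" "r j l" and z: "z \<in> axis l" for i j l z
  proof (rule beh[OF ijl(2,1) axis_V[OF z]])
    obtain w where w: "w \<in> axis i" "pr j x0 = pr j w" using base[OF ijl(1,2,4)] by blast
    have ij: "j \<noteq> i" using irr ijl by blast
    have "?D < d (pr j z) (pr j w)" using ijl(5) z w(2) unfolding r_def by simp
    then show "pr j z \<notin> pr j ` axis i" using small[OF ijl(2,1) ij _ w(1)] by fastforce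
  qed
  have tr: "r i l" if "i \<in> X" "j \<in> X" "l \<in> X" "r i j" "r j l" for i j l
    unfolding r_def
  proof
    fix z assume "z \<in> axis l"
    from nested[OF that this] obtain u where "u \<in> axis j" "pr i z = pr i u" by blast
    then show "?D < d (pr i z) (pr i x0)" using that(4) unfolding r_def by simp
  qed
  obtain Y where Y: "Y \<subseteq> X" "card X \<le> card Y * card Y"
    "(\<forall>x\<in>Y. \<forall>y\<in>Y. x \<noteq> y \<longrightarrow> r x y \<or> r y x) \<or> (\<forall>x\<in>Y. \<forall>y\<in>Y. \<not> r x y)"
    using chain_or_antichain[of X r] X(1) irr tr by blast
  \<comment> \<open>In an antichain only one point of the other axis is known to project within
    \<open>?D\<close> of \<open>pr i x0\<close>; the diameter of the projection adds another
    \<open>?D\<close>.\<close>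
  let ?R = "2 * ?D"
  have DR: "c \<le> ?R" if "c \<le> ?D" for c using that by simp
  \<comment> \<open>The two places are \<open>pr i x0\<close> and \<open>e\<close>. In a chain, axes
    below \<open>i\<close> project near \<open>pr i x0\<close> and those above \<open>i\<close> near
    the projection of any fixed axis above \<open>i\<close>. If nothing lies above, or in an
    antichain, \<open>e\<close> is \<open>pr i x0\<close> itself.\<close>
  have "\<exists>e\<in>axis i. \<forall>j\<in>Y. j \<noteq> i \<longrightarrow> (\<forall>u\<in>axis j. d (pr i u) (pr i x0) \<le> ?R \<or> d (pr i u) e \<le> ?R)"
    if i: "i \<in> Y" for i
    using Y(3)
  proof
    assume anti: "\<forall>x\<in>Y. \<forall>y\<in>Y. \<not> r x y"
    show ?thesis
    proof (intro bexI[of _ "pr i x0"] ballI impI disjI1)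
      fix j u assume j: "j \<in> Y" "j \<noteq> i" "u \<in> axis j"
      obtain v where v: "v \<in> axis j" "d (pr i v) (pr i x0) \<le> ?D"
        using anti i j unfolding r_def by (meson not_le)
      have "d (pr i u) (pr i v) \<le> ?D" using small[of i j u v] i j v Y(1) by blast
      then show "d (pr i u) (pr i x0) \<le> ?R"
        unfolding mult_2
        by (rule order_trans[OF dist_triangle[OF prV[of i u] prV[of i v] prV[of i x0]] add_mono[OF _ v(2)]])
    qed (rule prA)
  next
    assume chain: "\<forall>x\<in>Y. \<forall>y\<in>Y. x \<noteq> y \<longrightarrow> r x y \<or> r y x"
    have below: "d (pr i u) (pr i x0) \<le> ?D" if j: "j \<in> Y" "j \<noteq> i" "u \<in> axis j" "r j i" for j u
    proof -
      obtain w where "w \<in> axis j" "pr i x0 = pr i w" using base[of j i] j i Y(1) by blast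
      then show ?thesis using small[of i j u w] j i Y(1) by auto
    qed
    show ?thesis
    proof (cases "\<exists>j\<in>Y. r i j")
      case False
      then have rji: "r j i" if "j \<in> Y" "j \<noteq> i" for j using chain i that by blast
      show ?thesis
      proof (intro bexI[of _ "pr i x0"] ballI impI disjI1)
        fix j u assume "j \<in> Y" "j \<noteq> i" "u \<in> axis j"
        then show "d (pr i u) (pr i x0) \<le> ?R" using below[of j u] rji[of j] DR by blast
      qed (rule prA)
    next
      case True
      then obtain j0 where j0: "j0 \<in> Y" "r i j0" by blast
      obtain a where a: "a \<in> axis j0" using axis_nonempty by blast
      have XX: "i \<in> X" "j0 \<in> X" using i j0 Y(1) by auto
      have ij0: "i \<noteq> j0" using irr XX j0 by blast
      show ?thesis
      proof (intro bexI[of _ "pr i a"] ballI impI)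
        fix j u assume j: "j \<in> Y" "j \<noteq> i" and u: "u \<in> axis j"
        have jX: "j \<in> X" using j Y(1) by auto
        \<comment> \<open>Of two axes above \<open>i\<close>, the higher one projects inside the
          projection of the lower one by \<open>nested\<close>, so in either order the two points
          are compared inside the projection of a single axis.\<close>
        have "d (pr i u) (pr i a) \<le> ?D" if rij: "r i j"
        proof -
          consider "j = j0" | "r j j0" | "r j0 j" using chain j j0 by blast
          then show ?thesis
          proof cases
            case 1
            then show ?thesis using small[OF XX ij0 _ a] u by blast
          next
            case 2
            then obtain w where "w \<in> axis j" "pr i a = pr i w"
              using nested[OF XX(1) jX XX(2) rij _ a] by blast
            then show ?thesis using small[OF XX(1) jX j(2)[symmetric] u] by simp
          next
            case 3
            then obtain w where "w \<in> axis j0" "pr i u = pr i w"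
              using nested[OF XX jX j0(2) _ u] by blast
            then show ?thesis using small[OF XX ij0 _ a] by simp
          qed
        qed
        moreover have "r i j \<or> r j i" using chain i j by blast
        ultimately have "d (pr i u) (pr i x0) \<le> ?D \<or> d (pr i u) (pr i a) \<le> ?D"
          using below[OF j u] by blast
        then show "d (pr i u) (pr i x0) \<le> ?R \<or> d (pr i u) (pr i a) \<le> ?R" using DR by blast
      qed (rule prA)
    qed
  qed
  then obtain e where e: "\<And>i. i \<in> Y \<Longrightarrow> e i \<in> axis i"
    "\<And>i j u. i \<in> Y \<Longrightarrow> j \<in> Y \<Longrightarrow> j \<noteq> i \<Longrightarrow> u \<in> axis j \<Longrightarrow>
      d (pr i u) (pr i x0) \<le> ?R \<or> d (pr i u) (e i) \<le> ?R" by metis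
  have "\<exists>N\<in>{P, 2 * P}. \<forall>a\<in>{pr i x0, e i}. \<forall>b\<in>{pr i x0, e i}. 2 * ?R < d (\<phi> (i [^]\<^bsub>G\<^esub> N) a) b"
    if i: "i \<in> Y" for i
  proof -
    have iX: "i \<in> X" using i Y(1) by auto
    have "4 * ?R < P * tl i" using P X(3)[OF iX] by simp
    from power_avoiding[OF ni X(2)[OF iX] prA[of i x0] e(1)[OF i] this] show ?thesis .
  qed
  then have "\<forall>i\<in>Y. \<exists>N. N \<in> {P, 2 * P} \<and>
      (\<forall>a\<in>{pr i x0, e i}. \<forall>b\<in>{pr i x0, e i}. 2 * ?R < d (\<phi> (i [^]\<^bsub>G\<^esub> N) a) b)"
    by blast
  from bchoice[OF this] obtain N where "\<forall>i\<in>Y. N i \<in> {P, 2 * P} \<and>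
      (\<forall>a\<in>{pr i x0, e i}. \<forall>b\<in>{pr i x0, e i}. 2 * ?R < d (\<phi> (i [^]\<^bsub>G\<^esub> N i) a) b)" ..
  then have N: "\<And>i. i \<in> Y \<Longrightarrow> N i \<in> {P, 2 * P}"
    "\<And>i a b. i \<in> Y \<Longrightarrow> a \<in> {pr i x0, e i} \<Longrightarrow> b \<in> {pr i x0, e i} \<Longrightarrow>
       2 * ?R < d (\<phi> (i [^]\<^bsub>G\<^esub> N i) a) b" by blast+
  define f where "f i = i [^]\<^bsub>G\<^esub> N i" for i
  define U where "U i = {y \<in> V. ?R < d (pr i y) (pr i x0) \<and> ?R < d (pr i y) (e i)}" for i
  have fc: "f i \<in> carrier G" if "i \<in> Y" for i using Xc that Y(1) by (auto simp: f_def)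
  \<comment> \<open>All of the axis of \<open>j\<close> projects near the two places of
    \<open>i\<close>, while \<open>y\<close> does not. By \<open>beh\<close>, \<open>y\<close>
    therefore projects to the axis of \<open>j\<close> like a point of the axis of \<open>i\<close>,
    that is, near the two places of \<open>j\<close>.\<close>
  have disj: "U i \<inter> U j = {}" if ij: "i \<in> Y" "j \<in> Y" "i \<noteq> j" for i j
  proof (rule ccontr)
    assume "U i \<inter> U j \<noteq> {}"
    then obtain y where y: "y \<in> U i" "y \<in> U j" by blast
    have "pr i y \<notin> pr i ` axis j" using y(1) e(2)[OF ij(1,2)] ij(3) unfolding U_def by fastforce
    then have "pr j y \<in> pr j ` axis i" using beh[of i j y] ij Y(1) y by (auto simp: U_def)
    then show False using y(2) e(2)[OF ij(2,1,3)] unfolding U_def by fastforce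
  qed
  \<comment> \<open>Outside \<open>U i\<close> the projection is within \<open>?R\<close> of one of
    the places, which \<open>f i\<close> moves more than \<open>2 * ?R\<close> away from both; a
    margin of \<open>?R\<close> remains.\<close>
  have pp: "\<phi> (f i) y \<in> U i" if i: "i \<in> Y" and y: "y \<in> V" "y \<notin> U i" for i y
  proof -
    have iX: "i \<in> X" using i Y(1) by auto
    have eV: "e i \<in> V" using e(1)[OF i] axis_V by blast
    have "\<phi> (f i) ` axis i = axis i"
      unfolding f_def using pow_image[OF Xc[OF iX] _ axis_image_self[OF Xc[OF iX]]] axis_V by blast
    then have eq: "pr i (\<phi> (f i) y) = \<phi> (f i) (pr i y)"
      unfolding pr_def using proj_act[OF A[OF iX] fc[OF i]] y by blast
    obtain a where a: "a \<in> {pr i x0, e i}" "d (pr i y) a \<le> ?R"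
      using y by (fastforce simp: U_def)
    have aV: "a \<in> V" using a prV eV by auto
    have iso: "d (\<phi> (f i) a) (\<phi> (f i) (pr i y)) = d (pr i y) a"
      using dist_act[OF fc[OF i] aV prV] dist_sym[OF aV prV] by simp
    have "?R < d (\<phi> (f i) (pr i y)) b" if b: "b \<in> {pr i x0, e i}" for b
    proof -
      have bV: "b \<in> V" using b prV eV by auto
      have "2 * ?R < d (\<phi> (f i) a) b" unfolding f_def using N(2)[OF i a(1) b] .
      then show ?thesis
        using dist_triangle[OF act_V[OF fc[OF i] aV] act_V[OF fc[OF i] prV] bV, of i y] iso a(2) by linarith
    qed
    then show ?thesis using eq act_V[OF fc[OF i] y(1)] by (simp add: U_def)
  qed
  show ?thesis
  proof (rule that[OF Y(2)])
    assume "2 \<le> card Y"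
    show "entropy G S \<ge> ln (real (card Y - 1)) / real l"
    proof (rule ping_pong_entropy[OF S _ \<open>2 \<le> card Y\<close> l, of f U x0])
      show "finite Y" using Y(1) X(1) finite_subset by blast
      show "f i \<in> word_ball G S l" if "i \<in> Y" for i
        unfolding f_def using ball[OF _ N(1)[OF that]] that Y(1) by blast
      show "x0 \<notin> U i" for i using dist_self by (simp add: U_def)
    qed (use disj pp x0 in \<open>auto simp: U_def\<close>)
  qed
qed

end

section \<open>Counting the conjugates of a hyperbolic element\<close>

lemma (in group) conj_pow:
  assumes "x \<in> carrier G" "h \<in> carrier G"
  shows "(x \<otimes> h \<otimes> inv x) [^] (n::nat) = x \<otimes> h [^] n \<otimes> inv x"
proof (induction n)
  case (Suc n)
  have "(x \<otimes> h \<otimes> inv x) [^] Suc n = (x \<otimes> h [^] n \<otimes> inv x) \<otimes> (x \<otimes> h \<otimes> inv x)"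
    by (simp only: nat_pow_Suc Suc)
  also have "\<dots> = x \<otimes> h [^] n \<otimes> (inv x \<otimes> x) \<otimes> h \<otimes> inv x"
    using assms by (simp only: m_assoc m_closed inv_closed nat_pow_closed)
  finally have "(x \<otimes> h \<otimes> inv x) [^] Suc n = x \<otimes> h [^] n \<otimes> (inv x \<otimes> x) \<otimes> h \<otimes> inv x" .
  then show ?case using assms by (simp add: m_assoc)
qed (use assms in simp)

text \<open>A maximal subset without pairs of distinct mutually inverse elements covers
  \<open>Z\<close> together with its inverses.\<close>

lemma (in group) half_up_to_inverse:
  assumes "finite Z" "Z \<subseteq> carrier G"
  obtains X where "X \<subseteq> Z" "card Z \<le> 2 * card X" "\<And>a b. a \<in> X \<Longrightarrow> b \<in> X \<Longrightarrow> a \<noteq> b \<Longrightarrow> a \<noteq> inv b"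
proof -
  define F where "F = {X. X \<subseteq> Z \<and> (\<forall>a\<in>X. \<forall>b\<in>X. a \<noteq> b \<longrightarrow> a \<noteq> inv b)}"
  have "finite F" "{} \<in> F" using assms by (auto simp: F_def)
  then obtain X where X: "X \<in> F" "\<And>Y. Y \<in> F \<Longrightarrow> X \<subseteq> Y \<Longrightarrow> X = Y"
    using finite_has_maximal[of F] by blast
  have "Z \<subseteq> X \<union> (\<lambda>a. inv a) ` X"
  proof
    fix z assume z: "z \<in> Z"
    show "z \<in> X \<union> (\<lambda>a. inv a) ` X"
    proof (rule ccontr)
      assume no: "z \<notin> X \<union> (\<lambda>a. inv a) ` X"
      have "a \<noteq> inv z" if "a \<in> X" for a
        using no that z assms(2) X(1) by (metis (lifting) F_def UnI2 image_eqI inv_inv mem_Collect_eq subsetD)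
      then have "insert z X \<in> F" using X(1) z no by (auto simp: F_def)
      then show False using X(2)[of "insert z X"] no by blast
    qed
  qed
  moreover have "finite X" using X(1) assms(1) finite_subset by (auto simp: F_def)
  ultimately have "card Z \<le> card X + card ((\<lambda>a. inv a) ` X)"
    by (meson card_Un_le card_mono finite_UnI finite_imageI le_trans)
  also have "\<dots> \<le> 2 * card X" using card_image_le[OF \<open>finite X\<close>, of "\<lambda>a. inv a"] by simp
  finally show ?thesis using that[of X] X(1) by (auto simp: F_def)
qed

lemma image_or_fibre_large:
  assumes "finite S"
  obtains "card S \<le> card (f ` S) * card (f ` S)"
  | c where "card S \<le> card {s \<in> S. f s = c} * card {s \<in> S. f s = c}"
proof -
  \<comment> \<open>The element 0 keeps \<open>Max\<close> defined when \<open>S\<close> is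
    empty.\<close>
  define M where "M = Max (insert 0 ((\<lambda>c. card {s \<in> S. f s = c}) ` f ` S))"
  have fin: "finite (insert 0 ((\<lambda>c. card {s \<in> S. f s = c}) ` f ` S))" using assms by simp
  have "card S \<le> (\<Sum>c\<in>f ` S. card {s \<in> S. f s = c})"
  proof -
    have "S = (\<Union>c\<in>f ` S. {s \<in> S. f s = c})" by auto
    then show ?thesis using card_UN_le[of "f ` S" "\<lambda>c. {s \<in> S. f s = c}"] assms by simp
  qed
  also have "\<dots> \<le> (\<Sum>c\<in>f ` S. M)"
    by (rule sum_mono) (use Max_ge[OF fin] in \<open>auto simp: M_def\<close>)
  finally have le: "card S \<le> card (f ` S) * M" by simp
  show thesis
  proof (cases "M \<le> card (f ` S)")
    case True
    then show ?thesis using that(1) order_trans[OF le mult_le_mono2] by blast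
  next
    case False
    then have "card S \<le> M * M" using order_trans[OF le mult_le_mono1[of "card (f ` S)" M M]] by simp
    moreover have "M \<in> insert 0 ((\<lambda>c. card {s \<in> S. f s = c}) ` f ` S)"
      unfolding M_def by (rule Max_in[OF fin]) simp
    ultimately show ?thesis using that(2) False by auto
  qed
qed

context tree_action
begin

text \<open>Either the generators conjugate \<open>h\<close> to many different elements, or many of them differ by
  elements \<open>c\<close> of the centralizer of \<open>h\<close>; the latter act freely on the conjugates of \<open>t h t\<^sup>-\<^sup>1\<close>.\<close>

lemma many_conjugates:
  assumes ni: "without_inversions G E \<phi>" and acyl: "acylindrical G V E \<phi> k"
    and S: "finite S" "S \<subseteq> carrier G" "generate G S = carrier G" and h: "hyp h"
    and t: "t \<in> S" "t \<otimes>\<^bsub>G\<^esub> h \<otimes>\<^bsub>G\<^esub> inv\<^bsub>G\<^esub> t \<noteq> h" "t \<otimes>\<^bsub>G\<^esub> h \<otimes>\<^bsub>G\<^esub> inv\<^bsub>G\<^esub> t \<noteq> inv\<^bsub>G\<^esub> h"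
  obtains Z where "finite Z" "card S \<le> card Z * card Z"
    "Z \<subseteq> (\<lambda>x. x \<otimes>\<^bsub>G\<^esub> h \<otimes>\<^bsub>G\<^esub> inv\<^bsub>G\<^esub> x) ` word_ball G S 3"
proof -
  let ?B = "word_ball G S"
  define cj where "cj x = x \<otimes>\<^bsub>G\<^esub> h \<otimes>\<^bsub>G\<^esub> inv\<^bsub>G\<^esub> x" for x
  note Z = that[folded cj_def[abs_def]]
  have hc: "h \<in> carrier G" using hyp_carrier h .
  have tc: "t \<in> carrier G" using t S by auto
  have S1: "s \<in> ?B 1" if "s \<in> S" for s using grp.generator_word_ball[OF S(2,3) that] .
  show ?thesis
  proof (rule image_or_fibre_large[OF S(1), of cj])
    assume "card S \<le> card (cj ` S) * card (cj ` S)"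
    moreover have "S \<subseteq> ?B 3" using S1 grp.word_ball_mono[OF S(2,3), of 1 3] by auto
    ultimately show ?thesis using Z[of "cj ` S"] S(1) by (auto simp: cj_def[abs_def])
  next
    fix c assume le: "card S \<le> card {s \<in> S. cj s = c} * card {s \<in> S. cj s = c}"
    define F where "F = {s \<in> S. cj s = c}"
    note le = le[folded F_def]
    show ?thesis
    proof (cases "F = {}")
      case True
      then show ?thesis using Z[of "{}"] le by simp
    next
      case False
      then obtain s1 where s1: "s1 \<in> F" by blast
      have Fc: "s \<in> carrier G" "s \<in> S" "cj s = c" if "s \<in> F" for s using that S by (auto simp: F_def)
      \<comment> \<open>Two elements of one fibre conjugate \<open>h\<close> in the same way, so
        these quotients centralize \<open>h\<close>.\<close>
      define q where "q s = inv\<^bsub>G\<^esub> s1 \<otimes>\<^bsub>G\<^esub> s" for s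
      have qc: "q s \<in> carrier G" if "s \<in> F" for s using Fc[OF that] Fc[OF s1] by (simp add: q_def)
      have conj_comm: "x \<otimes>\<^bsub>G\<^esub> g = y \<otimes>\<^bsub>G\<^esub> x"
        if "x \<otimes>\<^bsub>G\<^esub> g \<otimes>\<^bsub>G\<^esub> inv\<^bsub>G\<^esub> x = y" "x \<in> carrier G" "g \<in> carrier G" for x y g
        using that by (auto simp: grp.m_assoc)
      have inv_mult_comm: "(inv\<^bsub>G\<^esub> x \<otimes>\<^bsub>G\<^esub> y) \<otimes>\<^bsub>G\<^esub> g = g \<otimes>\<^bsub>G\<^esub> (inv\<^bsub>G\<^esub> x \<otimes>\<^bsub>G\<^esub> y)"
        if "x \<otimes>\<^bsub>G\<^esub> g \<otimes>\<^bsub>G\<^esub> inv\<^bsub>G\<^esub> x = y \<otimes>\<^bsub>G\<^esub> g \<otimes>\<^bsub>G\<^esub> inv\<^bsub>G\<^esub> y"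
          "x \<in> carrier G" "y \<in> carrier G" "g \<in> carrier G" for x y g
      proof -
        let ?z = "x \<otimes>\<^bsub>G\<^esub> g \<otimes>\<^bsub>G\<^esub> inv\<^bsub>G\<^esub> x"
        have "inv\<^bsub>G\<^esub> x \<otimes>\<^bsub>G\<^esub> y \<otimes>\<^bsub>G\<^esub> g = inv\<^bsub>G\<^esub> x \<otimes>\<^bsub>G\<^esub> (?z \<otimes>\<^bsub>G\<^esub> y)"
          using conj_comm[OF that(1)[symmetric] that(3,4)] that(2-4) by (simp add: grp.m_assoc)
        also have "\<dots> = (inv\<^bsub>G\<^esub> x \<otimes>\<^bsub>G\<^esub> x) \<otimes>\<^bsub>G\<^esub> g \<otimes>\<^bsub>G\<^esub> (inv\<^bsub>G\<^esub> x \<otimes>\<^bsub>G\<^esub> y)"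
          using that(2-4) by (simp only: grp.m_assoc grp.m_closed grp.inv_closed)
        finally show ?thesis using that(2-4) by simp
      qed
      have qh: "q s \<otimes>\<^bsub>G\<^esub> h = h \<otimes>\<^bsub>G\<^esub> q s" if "s \<in> F" for s
        unfolding q_def by (rule inv_mult_comm) (use Fc[OF that] Fc[OF s1] hc in \<open>auto simp: cj_def\<close>)
      define g where "g = cj t"
      have gc: "g \<in> carrier G" and gh: "hyp g" "tl h = tl g" and g_ne: "g \<noteq> h" "g \<noteq> inv\<^bsub>G\<^esub> h"
        using hyp_conj[OF h tc] tl_conj[OF hc tc] t hc tc by (simp_all add: g_def cj_def)
      have ne: "h \<noteq> g" "h \<noteq> inv\<^bsub>G\<^esub> g" using g_ne gc by auto
      have cjq: "cj (q s \<otimes>\<^bsub>G\<^esub> t) = q s \<otimes>\<^bsub>G\<^esub> g \<otimes>\<^bsub>G\<^esub> inv\<^bsub>G\<^esub> (q s)" if "s \<in> F" for s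
        using qc[OF that] tc hc by (simp add: cj_def g_def grp.m_assoc grp.inv_mult_group)
      \<comment> \<open>Equal conjugates of \<open>g\<close> make \<open>?c\<close> commute with
        \<open>g\<close>, and it commutes with \<open>h\<close> by construction;
        \<open>commuting_trivial\<close> forces it to be the identity.\<close>
      have "inj_on (\<lambda>s. cj (q s \<otimes>\<^bsub>G\<^esub> t)) F"
      proof (rule inj_onI)
        fix s s' assume s: "s \<in> F" "s' \<in> F" and eq: "cj (q s \<otimes>\<^bsub>G\<^esub> t) = cj (q s' \<otimes>\<^bsub>G\<^esub> t)"
        let ?c = "inv\<^bsub>G\<^esub> (q s) \<otimes>\<^bsub>G\<^esub> q s'"
        have cc: "?c \<in> carrier G" using qc s by simp
        have "?c \<otimes>\<^bsub>G\<^esub> g = g \<otimes>\<^bsub>G\<^esub> ?c"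
          by (rule inv_mult_comm) (use eq cjq s qc gc in auto)
        moreover have "?c \<otimes>\<^bsub>G\<^esub> h = h \<otimes>\<^bsub>G\<^esub> ?c"
          by (rule inv_mult_comm)
             (use commute_conj[OF hc qc qh] s qc hc in auto)
        ultimately have "?c = \<one>\<^bsub>G\<^esub>" using commuting_trivial[OF ni acyl h gh ne cc] by blast
        then have "q s' = q s"
          using qc s by (metis grp.inv_closed grp.inv_equality grp.inv_inv)
        then show "s = s'"
          unfolding q_def using Fc s s1 by (metis grp.inv_closed grp.l_inv grp.inv_solve_left grp.m_assoc grp.m_closed grp.l_one grp.inv_inv)
      qed
      then have "card ((\<lambda>s. cj (q s \<otimes>\<^bsub>G\<^esub> t)) ` F) = card F" by (rule card_image)
      moreover have "q s \<otimes>\<^bsub>G\<^esub> t \<in> ?B 3" if "s \<in> F" for s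
        using grp.mult_word_ball[OF S(2,3) grp.mult_word_ball[OF S(2,3) grp.inv_word_ball[OF S(2,3) S1] S1] S1]
          Fc that s1 t by (fastforce simp: q_def numeral_3_eq_3)
      ultimately show ?thesis
        using Z[of "(\<lambda>s. cj (q s \<otimes>\<^bsub>G\<^esub> t)) ` F"] le S(1) by (auto simp: F_def)
    qed
  qed
qed

text \<open>Combines \<open>card S \<le> card Z * card Z\<close>,
  \<open>card Z \<le> 2 * card X\<close> and \<open>card X \<le> m * m\<close>. The length
  \<open>32 * k + 42\<close> is twice the length 3 of the conjugators plus length 2 of
  \<open>h\<close> times the largest power \<open>2 * ?P\<close>.\<close>

lemma entropy_bound:
  assumes ni: "without_inversions G E \<phi>" and ne: "non_elementary G V E \<phi>"
    and acyl: "acylindrical G V E \<phi> k"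
    and S: "finite S" "S \<subseteq> carrier G" "generate G S = carrier G"
  obtains m where "card S \<le> 4 * m ^ 4"
    "m \<ge> 2 \<Longrightarrow> entropy G S \<ge> ln (real (m - 1)) / real (32 * k + 42)"
proof -
  obtain W where W: "minimal_subtree G V E \<phi> W" "\<not> is_point W" "\<not> is_line E W"
    using ne by (auto simp: non_elementary_def)
  let ?B = "word_ball G S"
  have S1: "s \<in> ?B 1" if "s \<in> S" for s using grp.generator_word_ball[OF S(2,3) that] .
  obtain h where h: "hyp h" "h \<in> S \<or> (\<exists>s\<in>S. \<exists>t\<in>S. h = s \<otimes>\<^bsub>G\<^esub> t)"
    using hyperbolic_exists[OF W(1,2) S] by blast
  have hc: "h \<in> carrier G" using hyp_carrier h(1) .
  have h2: "h \<in> ?B 2"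
    using h(2)
  proof
    assume "h \<in> S"
    then show ?thesis using S1 grp.word_ball_mono[OF S(2,3), of 1 2] by auto
  next
    assume "\<exists>s\<in>S. \<exists>t\<in>S. h = s \<otimes>\<^bsub>G\<^esub> t"
    then show ?thesis using grp.mult_word_ball[OF S(2,3) S1 S1] by (fastforce simp: numeral_2_eq_2)
  qed
  obtain t where t: "t \<in> S" "t \<otimes>\<^bsub>G\<^esub> h \<otimes>\<^bsub>G\<^esub> inv\<^bsub>G\<^esub> t \<noteq> h" "t \<otimes>\<^bsub>G\<^esub> h \<otimes>\<^bsub>G\<^esub> inv\<^bsub>G\<^esub> t \<noteq> inv\<^bsub>G\<^esub> h"
    using exists_conj_other_axis[OF ni W(1,3) S(2,3) h(1)] .
  obtain Z where Z: "finite Z" "card S \<le> card Z * card Z"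
    "Z \<subseteq> (\<lambda>x. x \<otimes>\<^bsub>G\<^esub> h \<otimes>\<^bsub>G\<^esub> inv\<^bsub>G\<^esub> x) ` ?B 3"
    using many_conjugates[OF ni acyl S h(1) t] .
  have B3: "?B 3 \<subseteq> carrier G" using grp.word_ball_closed[OF S(2,3)] .
  then have "(\<lambda>x. x \<otimes>\<^bsub>G\<^esub> h \<otimes>\<^bsub>G\<^esub> inv\<^bsub>G\<^esub> x) ` ?B 3 \<subseteq> carrier G"
    using hc by (auto dest: subsetD)
  with Z(3) have "Z \<subseteq> carrier G" by (rule subset_trans)
  from grp.half_up_to_inverse[OF Z(1) this]
  obtain X where X: "X \<subseteq> Z" "card Z \<le> 2 * card X"
    "\<And>a b. a \<in> X \<Longrightarrow> b \<in> X \<Longrightarrow> a \<noteq> b \<Longrightarrow> a \<noteq> inv\<^bsub>G\<^esub> b" by blast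
  have conj: "\<exists>x\<in>?B 3. g = x \<otimes>\<^bsub>G\<^esub> h \<otimes>\<^bsub>G\<^esub> inv\<^bsub>G\<^esub> x" if "g \<in> X" for g using that X(1) Z(3) by auto
  \<comment> \<open>Solves \<open>8 * (t + k) < ?P * t\<close> for all \<open>t \<ge> 1\<close> at
    once, so the bound does not depend on the translation length of \<open>h\<close>.\<close>
  let ?P = "8 * k + 9"
  obtain m where m: "card X \<le> m * m" "m \<ge> 2 \<Longrightarrow> entropy G S \<ge> ln (real (m - 1)) / real (32 * k + 42)"
  proof (rule entropy_of_conjugate_family[OF ni acyl S, of X "tl h" ?P "32 * k + 42"])
    show "finite X" using X(1) Z(1) finite_subset by blast
    show "hyp g" "tl g = tl h" if "g \<in> X" for g
      using conj[OF that] B3 hyp_conj[OF h(1)] tl_conj[OF hc] by auto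
    have "8 * (t + k) < ?P * t" if "t > 0" for t
      using that by (cases t) (simp_all add: algebra_simps)
    then show "8 * (tl h + k) < ?P * tl h" using hyp_tl_pos[OF h(1)] by blast
    show "g [^]\<^bsub>G\<^esub> N \<in> ?B (32 * k + 42)" if g: "g \<in> X" and N: "N \<in> {?P, 2 * ?P}" for g N
    proof -
      obtain x where x: "x \<in> ?B 3" "g = x \<otimes>\<^bsub>G\<^esub> h \<otimes>\<^bsub>G\<^esub> inv\<^bsub>G\<^esub> x" using conj[OF g] by blast
      have "g [^]\<^bsub>G\<^esub> N \<in> ?B (2 * 3 + N * 2)"
        using grp.conj_word_ball[OF S(2,3) grp.pow_word_ball[OF S(2,3) h2] x(1), of N]
          grp.conj_pow[of x h N] x B3 hc by auto
      moreover have "2 * 3 + N * 2 \<le> 32 * k + 42" using N by auto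
      ultimately show ?thesis using grp.word_ball_mono[OF S(2,3)] by blast
    qed
  qed (use X(3) that in auto)
  have "card Z \<le> 2 * (m * m)" using X(2) m(1) by simp
  then have "card Z * card Z \<le> (2 * (m * m)) * (2 * (m * m))" by (rule mult_le_mono) fact
  then have "card S \<le> 4 * m ^ 4" using Z(2) by (simp add: power4_eq_xxxx)
  then show ?thesis using that[of m] m(2) by blast
qed

end

text \<open>With N the root, \<open>m < N\<close> would give \<open>N ^ 32 \<le> 4 * N ^ 4\<close>,
  so \<open>N ^ 28 \<le> 4\<close>, which is absurd for \<open>N > 2\<close>.\<close>

lemma root_32_le:
  assumes n: "n \<le> 4 * m ^ 4" and big: "root 32 (real n) > 2"
  shows "root 32 (real n) \<le> real m"
proof (rule ccontr)
  define N where "N = root 32 (real n)"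
  assume "\<not> root 32 (real n) \<le> real m"
  then have "real m ^ 4 \<le> N ^ 4" by (intro power_mono) (auto simp: N_def)
  moreover have "real n = N ^ 32" by (simp add: N_def)
  moreover have "real n \<le> 4 * real m ^ 4"
    using n by (metis of_nat_le_iff of_nat_mult of_nat_numeral of_nat_power)
  ultimately have "N ^ 32 \<le> 4 * N ^ 4" by linarith
  moreover have "N ^ 32 = N ^ 28 * N ^ 4" by (simp flip: power_add)
  moreover have N: "N > 2" using big by (simp add: N_def)
  then have "N ^ 4 > 0" by simp
  ultimately have "N ^ 28 \<le> 4" by (metis mult_le_cancel_right_pos)
  moreover have "(2::real) ^ 28 \<le> N ^ 28" using N by (intro power_mono) auto
  ultimately have "(2::real) ^ 28 \<le> 4" by (rule order_trans[rotated])
  then show False by simp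
qed

theorem theorem1:
  fixes G :: "('g, 'm) monoid_scheme"
    and V :: "'v set" and E :: "'v \<Rightarrow> 'v \<Rightarrow> bool" and \<phi> :: "'g \<Rightarrow> 'v \<Rightarrow> 'v"
    and S :: "'g set" and k n :: nat
  assumes "tree_action G V E \<phi>"
    and "without_inversions G E \<phi>"
    and "non_elementary G V E \<phi>"
    and "acylindrical G V E \<phi> k"
    and "finite S" and "S \<subseteq> carrier G" and "generate G S = carrier G" and "card S = n"
  shows "entropy G S \<ge> ln (root 32 (real n) - 1) / (80 * (real k + 3))"
proof -
  interpret tree_action G V E \<phi> by fact
  let ?N = "root 32 (real n)"
  show ?thesis
  proof (cases "?N > 2")
    case False
    \<comment> \<open>For at most one generator the argument is not positive, and the total function
      \<open>ln\<close> still takes a value that is at most 0 there.\<close>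
    have "ln (?N - 1) \<le> 0"
    proof (cases "n = 0")
      case True
      then show ?thesis using ln_minus[of "1::real"] by simp
    next
      case n: False
      then have "?N \<ge> 1" by simp
      then show ?thesis using False by (cases "?N = 1") auto
    qed
    then have "ln (?N - 1) / (80 * (real k + 3)) \<le> 0" by (simp add: divide_le_0_iff)
    also have "0 \<le> entropy G S" using grp.entropy_nonneg assms by blast
    finally show ?thesis .
  next
    case True
    obtain m where m: "n \<le> 4 * m ^ 4" "m \<ge> 2 \<Longrightarrow> entropy G S \<ge> ln (real (m - 1)) / real (32 * k + 42)"
      using entropy_bound[of k S] assms by metis
    have Nm: "?N \<le> real m" using root_32_le[OF m(1) True] .
    then have m2: "m > 2" using True by linarith
    have "ln (?N - 1) / (80 * (real k + 3)) \<le> ln (real (m - 1)) / (80 * (real k + 3))"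
    proof (rule divide_right_mono)
      have "?N - 1 > 0" "?N - 1 \<le> real (m - 1)" using Nm True m2 by linarith+
      then show "ln (?N - 1) \<le> ln (real (m - 1))" by (rule ln_mono[rotated])
    qed simp
    also have "\<dots> \<le> ln (real (m - 1)) / real (32 * k + 42)"
      by (intro divide_left_mono) (use m2 in auto)
    also have "\<dots> \<le> entropy G S" using m m2 by simp
    finally show ?thesis .
  qed
qed

end
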